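(* (i) Let $R$ be a two-story region with a fixed choice of ghost curves, and let $t_0,t_1$ be tilings of $R$ such that $t_1$ is obtained from $t_0$ by a single positive trit. Then $P_{t_1}(q)-P_{t_0}(q)=q^k(q-1)$ for some $k\in\mathbb{Z}$; consequently $P_{t_1}'(1)-P_{t_0}'(1)=1$. (ii) If $R$ is a duplex region and $t_0,t_1$ are any two tilings of $R$, then there exists a finite sequence of flips and trits taking $t_0$ to $t_1$.
   Context: Cubes: for $(x,y,z)\in\mathbb{Z}^3$ the cube $C(x,y,z)=(x,y,z)+[0,1]^3$ is white if $x+y+z$ is even and black otherwise. A region is a finite union of such cubes; a dimer is the union of two cubes sharing a face ($x$-, $y$- or $z$-dimer according to the direction of adjacency); a tiling is a set of dimers with disjoint interiors covering the region. A flip removes two dimers of a tiling whose union is a $2\times2\times1$ box (any orientation) and replaces them by the other pair of dimers tiling that box. Trit: let $K$ be a $2\times2\times2$ cube (union of eight cubes) contained in the region, and suppose the tiling contains three dimers contained in $K$, one $x$-, one $y$- and one $z$-dimer. The two cubes of $K$ they leave uncovered are opposite corners of $K$, one white (center $c_W$) and one black (center $c_B$), and there is exactly one other way to tile these six cubes by three dimers; replacing the three dimers by the other three is a trit. For such a triple, let $m$ be the center of $K$ and, for one of the dimers with white cube center $w$ and black cube center $b$, let $\chi=\operatorname{sign}\det(c_B-c_W,\,w-m,\,b-w)$; this value is $\pm1$, is the same for each of the three dimers, and is opposite for the two triples. A trit is positive if it replaces the triple with $\chi=-1$ by the triple with $\chi=+1$, negative otherwise. Two-story region: $R\subset\mathbb{R}^2\times[0,2]$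 with floors $R\cap(\mathbb{R}^2\times[0,1])$ (floor 0) and $R\cap(\mathbb{R}^2\times[1,2])$ (floor 1) both nonempty, connected and simply connected; $D_0,D_1\subset\mathbb{R}^2$ are their projections; $R$ is duplex if $D_0=D_1$. Invariant: the unit square $[x,x+1]\times[y,y+1]$ is white if $x+y$ is even, else black. For a tiling $t$, each $z$-dimer $C(x,y,0)\cup C(x,y,1)$ gives a jewel at square $[x,x+1]\times[y,y+1]$ with that square's color; each non-$z$ dimer is drawn as the oriented segment from the center of the projection of its white cube to the center of the projection of its black cube. These form disjoint oriented closed curves and paths whose endpoints are the holes (squares of $D_0\triangle D_1$), each hole being an endpoint of exactly one path, initial or terminal depending only on $R$. A choice of ghost curves is a fixed set of oriented curves, each from a terminal hole center to an initial hole center, using each hole once, avoiding closures of squares of $D_0\cap D_1$. With them all curves close up; $k_t(j)$ is the sum of the winding numbers (counterclockwise positive) of all closed curves around jewel $j$, and $P_t(q)=\sum_{j\text{ black}}q^{k_t(j)}-\sum_{j\text{ white}}q^{k_t(j)}$. *)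

theory Defs
  imports "HOL-Complex_Analysis.Winding_Numbers"
begin

text \<open>
  The triple \<open>(x, y, z)\<close> stands for the unit cube \<open>(x, y, z) + [0,1]\<^sup>3\<close>, a finite set of triples
  for the region that is the union of its cubes, a two-element set of triples for a dimer, and
  the pair \<open>(x, y)\<close> for the unit square \<open>[x, x+1] \<times> [y, y+1]\<close>.  Under this encoding,
  disjointness of interiors is disjointness of sets of triples.
\<close>

type_synonym cube = "int \<times> int \<times> int"
type_synonym dimer = "cube set"
type_synonym square = "int \<times> int"
type_synonym curve = "real \<Rightarrow> complex"

section \<open>Cubes, dimers, tilings\<close>

fun cube_body :: "cube \<Rightarrow> (real^3) set" where
  "cube_body (x, y, z) =
     cbox (vector [of_int x, of_int y, of_int z])
          (vector [of_int x + 1, of_int y + 1, of_int z + 1])"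

fun cube_center :: "cube \<Rightarrow> real^3" where
  "cube_center (x, y, z) = vector [of_int x + 1/2, of_int y + 1/2, of_int z + 1/2]"

fun white :: "cube \<Rightarrow> bool" where
  "white (x, y, z) \<longleftrightarrow> even (x + y + z)"

definition x_dimer :: "dimer \<Rightarrow> bool" where
  "x_dimer d \<longleftrightarrow> (\<exists>x y z. d = {(x, y, z), (x + 1, y, z)})"

definition y_dimer :: "dimer \<Rightarrow> bool" where
  "y_dimer d \<longleftrightarrow> (\<exists>x y z. d = {(x, y, z), (x, y + 1, z)})"

definition z_dimer :: "dimer \<Rightarrow> bool" where
  "z_dimer d \<longleftrightarrow> (\<exists>x y z. d = {(x, y, z), (x, y, z + 1)})"

definition is_dimer :: "dimer \<Rightarrow> bool" where
  "is_dimer d \<longleftrightarrow> x_dimer d \<or> y_dimer d \<or> z_dimer d"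

definition is_tiling :: "cube set \<Rightarrow> dimer set \<Rightarrow> bool" where
  "is_tiling R t \<longleftrightarrow> (\<forall>d\<in>t. is_dimer d) \<and> disjoint t \<and> \<Union>t = R"

text \<open>Only used for sets containing exactly one white and exactly one black cube.\<close>

definition white_cube :: "cube set \<Rightarrow> cube" where
  "white_cube S = (THE c. c \<in> S \<and> white c)"

definition black_cube :: "cube set \<Rightarrow> cube" where
  "black_cube S = (THE c. c \<in> S \<and> \<not> white c)"

section \<open>Flips and trits\<close>

definition flat_box :: "cube set \<Rightarrow> bool" where
  "flat_box B \<longleftrightarrow> (\<exists>x y z. B = {x, x + 1} \<times> {y, y + 1} \<times> {z} \<or>
                          B = {x, x + 1} \<times> {y} \<times> {z, z + 1} \<or>
                          B = {x} \<times> {y, y + 1} \<times> {z, z + 1})"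

definition flip :: "dimer set \<Rightarrow> dimer set \<Rightarrow> bool" where
  "flip t t' \<longleftrightarrow> (\<exists>B d1 d2 e1 e2. flat_box B \<and>
     d1 \<in> t \<and> d2 \<in> t \<and> d1 \<union> d2 = B \<and>
     is_dimer e1 \<and> is_dimer e2 \<and> e1 \<union> e2 = B \<and> {e1, e2} \<noteq> {d1, d2} \<and>
     t' = (t - {d1, d2}) \<union> {e1, e2})"

fun big_cube :: "cube \<Rightarrow> cube set" where
  "big_cube (x, y, z) = {x, x + 1} \<times> {y, y + 1} \<times> {z, z + 1}"

fun big_cube_center :: "cube \<Rightarrow> real^3" where
  "big_cube_center (x, y, z) = vector [of_int x + 1, of_int y + 1, of_int z + 1]"

definition trit_triple :: "cube \<Rightarrow> dimer set \<Rightarrow> bool" where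
  "trit_triple v T \<longleftrightarrow> (\<exists>dx dy dz. T = {dx, dy, dz} \<and> x_dimer dx \<and> y_dimer dy \<and> z_dimer dz \<and>
     dx \<subseteq> big_cube v \<and> dy \<subseteq> big_cube v \<and> dz \<subseteq> big_cube v)"

definition trit_at :: "cube set \<Rightarrow> cube \<Rightarrow> dimer set \<Rightarrow> dimer set \<Rightarrow> dimer set \<Rightarrow> dimer set \<Rightarrow> bool"
  where
  "trit_at R v T T' t t' \<longleftrightarrow> big_cube v \<subseteq> R \<and> T \<subseteq> t \<and> trit_triple v T \<and>
     is_tiling (\<Union>T) T' \<and> T' \<noteq> T \<and> t' = (t - T) \<union> T'"

definition trit :: "cube set \<Rightarrow> dimer set \<Rightarrow> dimer set \<Rightarrow> bool" where
  "trit R t t' \<longleftrightarrow> (\<exists>v T T'. trit_at R v T T' t t')"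

definition chi :: "cube \<Rightarrow> dimer set \<Rightarrow> dimer \<Rightarrow> real" where
  "chi v T d =
     (let cW = cube_center (white_cube (big_cube v - \<Union>T));
          cB = cube_center (black_cube (big_cube v - \<Union>T));
          m = big_cube_center v;
          w = cube_center (white_cube d);
          b = cube_center (black_cube d)
      in sgn (det (vector [cB - cW, w - m, b - w] :: real^3^3)))"

definition positive_trit :: "cube set \<Rightarrow> dimer set \<Rightarrow> dimer set \<Rightarrow> bool" where
  "positive_trit R t t' \<longleftrightarrow> (\<exists>v T T'. trit_at R v T T' t t' \<and>
     (\<forall>d\<in>T. chi v T d = -1) \<and> (\<forall>d\<in>T'. chi v T' d = 1))"

section \<open>Two-story and duplex regions\<close>

definition story :: "cube set \<Rightarrow> int \<Rightarrow> cube set" where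
  "story R i = {(x, y, z) \<in> R. z = i}"

definition shadow :: "cube set \<Rightarrow> int \<Rightarrow> square set" where
  "shadow R i = {(x, y). (x, y, i) \<in> R}"

definition two_story_region :: "cube set \<Rightarrow> bool" where
  "two_story_region R \<longleftrightarrow> finite R \<and> R = story R 0 \<union> story R 1 \<and>
     (\<forall>i\<in>{0, 1}. story R i \<noteq> {} \<and>
        connected (\<Union>(cube_body ` story R i)) \<and>
        simply_connected (\<Union>(cube_body ` story R i)))"

definition duplex_region :: "cube set \<Rightarrow> bool" where
  "duplex_region R \<longleftrightarrow> two_story_region R \<and> shadow R 0 = shadow R 1"

section \<open>Jewels, holes, ghost curves\<close>

text \<open>The plane is identified with the complex numbers, the setting of \<^const>\<open>winding_number\<close>.\<close>

fun square_center :: "square \<Rightarrow> complex" where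
  "square_center (x, y) = Complex (of_int x + 1/2) (of_int y + 1/2)"

fun square_body :: "square \<Rightarrow> complex set" where
  "square_body (x, y) = cbox (Complex (of_int x) (of_int y)) (Complex (of_int x + 1) (of_int y + 1))"

fun white_square :: "square \<Rightarrow> bool" where
  "white_square (x, y) \<longleftrightarrow> even (x + y)"

fun proj :: "cube \<Rightarrow> square" where
  "proj (x, y, z) = (x, y)"

definition jewels :: "dimer set \<Rightarrow> square set" where
  "jewels t = {(x, y). {(x, y, 0), (x, y, 1)} \<in> t}"

definition dimer_curve :: "dimer \<Rightarrow> curve" where
  "dimer_curve d = linepath (square_center (proj (white_cube d))) (square_center (proj (black_cube d)))"

definition holes :: "cube set \<Rightarrow> square set" where
  "holes R = (shadow R 0 - shadow R 1) \<union> (shadow R 1 - shadow R 0)"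

text \<open>
  Segments run from white to black cubes, so in every tiling the path ending at a hole starts
  there if the only cube of \<open>R\<close> over that hole is white, and terminates there if it is black.
\<close>

definition initial_holes :: "cube set \<Rightarrow> square set" where
  "initial_holes R = {s \<in> holes R. \<exists>c\<in>R. proj c = s \<and> white c}"

definition terminal_holes :: "cube set \<Rightarrow> square set" where
  "terminal_holes R = {s \<in> holes R. \<exists>c\<in>R. proj c = s \<and> \<not> white c}"

definition ghost_curves :: "cube set \<Rightarrow> curve set \<Rightarrow> bool" where
  "ghost_curves R G \<longleftrightarrow>
     (\<forall>g\<in>G. path g \<and> path_image g \<inter> \<Union>(square_body ` (shadow R 0 \<inter> shadow R 1)) = {}) \<and>
     bij_betw pathstart G (square_center ` terminal_holes R) \<and>
     bij_betw pathfinish G (square_center ` initial_holes R)"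

section \<open>The closed curves of a tiling and the invariant\<close>

definition arcs :: "curve set \<Rightarrow> dimer set \<Rightarrow> curve set" where
  "arcs G t = dimer_curve ` {d \<in> t. \<not> z_dimer d} \<union> G"

definition closed_chain :: "curve set \<Rightarrow> curve list \<Rightarrow> bool" where
  "closed_chain A cs \<longleftrightarrow> cs \<noteq> [] \<and> distinct cs \<and> set cs \<subseteq> A \<and>
     (\<forall>i<length cs. pathfinish (cs ! i) = pathstart (cs ! (Suc i mod length cs)))"

fun concat_curves :: "curve list \<Rightarrow> curve" where
  "concat_curves [] = undefined"
| "concat_curves [c] = c"
| "concat_curves (c # d # cs) = c +++ concat_curves (d # cs)"

text \<open>
  In \<open>arcs G t\<close> every endpoint is the start of exactly one arc and the end of exactly one arc, so
  each closed curve is determined by the set \<open>C\<close> of its arcs, and the closed chains with arc set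
  \<open>C\<close> are the rotations of one another; they parametrise that closed curve from different base
  points.
\<close>

definition closed_curves :: "curve set \<Rightarrow> curve set set" where
  "closed_curves A = {set cs | cs. closed_chain A cs}"

definition traverse :: "curve set \<Rightarrow> curve set \<Rightarrow> curve" where
  "traverse A C = concat_curves (SOME cs. closed_chain A cs \<and> set cs = C)"

definition jewel_winding :: "curve set \<Rightarrow> dimer set \<Rightarrow> square \<Rightarrow> int" where
  "jewel_winding G t j =
     (THE k. of_int k = (\<Sum>C\<in>closed_curves (arcs G t).
                           winding_number (traverse (arcs G t) C) (square_center j)))"

text \<open>
  A Laurent polynomial in \<open>q\<close> is regarded as a function of real \<open>q \<noteq> 0\<close>, which determines it.
\<close>

definition P :: "curve set \<Rightarrow> dimer set \<Rightarrow> real \<Rightarrow> real" where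
  "P G t q = (\<Sum>j\<in>{j \<in> jewels t. \<not> white_square j}. q powi jewel_winding G t j)
           - (\<Sum>j\<in>{j \<in> jewels t. white_square j}. q powi jewel_winding G t j)"

end

theory Submission
  imports Defs
begin

text \<open>
  Winding numbers of paths add up under concatenation, so the winding number of all closed curves
  of a tiling about a point is the sum of the (fractional) winding numbers of the single segments
  and ghost curves.  A trit at a \<open>2 \<times> 2\<close> block of squares replaces a path \<open>a, b, c\<close> by \<open>a, d, c\<close> and
  moves the jewel from \<open>d\<close> to \<open>b\<close>; hence the winding changes by that of the unit loop through the
  four centers, which is \<open>0\<close> about every other jewel and \<open>\<plusminus> 1\<close> about the center of the block.  The
  windings about the old and the new jewel are compared through the center of the block, which
  the half diagonals from \<open>d\<close> (before the trit) and from \<open>b\<close> (after it) reach without crossing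
  a curve.

  For a duplex region, the winding about the lattice points is a height function that jumps by one
  across each uncancelled segment.  It vanishes at the corners of squares outside the
  region, because loops in a simply connected floor do not wind around such squares.  As long as
  a horizontal dimer is present, some flip or trit lowers the sum of the absolute heights, or
  some flip keeps it and replaces a cycle of length two by two jewels.  So every tiling is
  connected to the one consisting of vertical dimers only.
\<close>

section \<open>Closed curves of a balanced family of paths\<close>

text \<open>Closed curves of different tilings are never matched with each other: a flip can merge
  or split them, and the parametrisation picked by \<open>traverse\<close> may move its base point.
  Only sums over arcs are compared, and the ghost curves cancel in every difference. For a trit the
  comparison cannot be made at a jewel, since the center of \<open>d\<close> lies on the new path
  and the center of \<open>b\<close> on the old one; a lattice point lies on no segment of either
  tiling. The shape q^k (q - 1) is a matter of signs. For a triple with path \<open>a, b, c\<close>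
  turning with orientation \<epsilon>, chi is \<epsilon> (2 \<open>parity d\<close> - 1). Hence a
  positive trit lowers the winding by one if the jewel is white and raises it by one if it is black.
  White jewels count negatively, so both cases give the same sign. In the duplex case only faces of
  positive height have to be analysed, because reversing all segments negates the heights. All moves
  come with their inverses, so two descents can be joined at the vertical tiling.\<close>

definition balanced :: "curve set \<Rightarrow> bool" where
  "balanced A \<longleftrightarrow> finite A \<and> (\<forall>\<gamma>\<in>A. path \<gamma>) \<and> inj_on pathstart A \<and> inj_on pathfinish A \<and>
     pathstart ` A = pathfinish ` A"

text \<open>On an open arc \<open>winding_number\<close> is the increment of log (w - z) divided by
  2 pi i: in general not an integer, and not locally constant in \<open>z\<close>. Only the sum over
  a balanced family behaves like a count.\<close>

definition total_winding :: "curve set \<Rightarrow> complex \<Rightarrow> complex" where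
  "total_winding A z = (\<Sum>\<gamma>\<in>A. winding_number \<gamma> z)"

definition succ_arc :: "curve set \<Rightarrow> curve \<Rightarrow> curve" where
  "succ_arc A \<gamma> = the_inv_into A pathstart (pathfinish \<gamma>)"

lemma succ_arc:
  assumes "balanced A" "\<gamma> \<in> A"
  shows "succ_arc A \<gamma> \<in> A" "pathstart (succ_arc A \<gamma>) = pathfinish \<gamma>"
proof -
  have inj: "inj_on pathstart A" and mem: "pathfinish \<gamma> \<in> pathstart ` A"
    using assms by (auto simp: balanced_def)
  show "succ_arc A \<gamma> \<in> A"
    unfolding succ_arc_def using the_inv_into_into[OF inj mem] by blast
  show "pathstart (succ_arc A \<gamma>) = pathfinish \<gamma>"
    unfolding succ_arc_def using f_the_inv_into_f[OF inj mem] by blast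
qed

lemma succ_arc_eqI:
  assumes "balanced A" "\<beta> \<in> A" "pathstart \<beta> = pathfinish \<gamma>"
  shows "succ_arc A \<gamma> = \<beta>"
  using assms by (auto simp: balanced_def succ_arc_def the_inv_into_f_f simp flip: assms(3))

lemma inj_on_succ_arc:
  assumes "balanced A"
  shows "inj_on (succ_arc A) A"
  using assms succ_arc(2)[OF assms] unfolding balanced_def inj_on_def by metis

lemma funpow_succ_arc_in:
  assumes "balanced A" "\<gamma> \<in> A"
  shows "(succ_arc A ^^ n) \<gamma> \<in> A"
  by (induction n) (simp_all add: assms succ_arc)

lemma funpow_succ_arc_cancel:
  assumes "balanced A" "\<gamma> \<in> A" "\<delta> \<in> A" "(succ_arc A ^^ n) \<gamma> = (succ_arc A ^^ n) \<delta>"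
  shows "\<gamma> = \<delta>"
  using assms(4)
proof (induction n)
  case (Suc n)
  then show ?case
    using inj_onD[OF inj_on_succ_arc[OF assms(1)]] funpow_succ_arc_in[OF assms(1)] assms(2,3)
    by simp
qed simp

text \<open>The next arc in a balanced family is forced, so a closed chain is a walk along
  \<open>succ_arc\<close> and its cyclic indices are iteration counts.\<close>

lemma closed_chain_nth:
  assumes A: "balanced A" and cs: "closed_chain A cs" and k: "k < length cs"
  shows "(succ_arc A ^^ n) (cs ! k) = cs ! ((k + n) mod length cs)"
proof (induction n)
  case 0
  then show ?case using k by simp
next
  case (Suc n)
  let ?i = "(k + n) mod length cs"
  have l: "length cs > 0" using k by linarith
  have "pathfinish (cs ! ?i) = pathstart (cs ! (Suc ?i mod length cs))"
    using cs l unfolding closed_chain_def by simp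
  moreover have "cs ! (Suc ?i mod length cs) \<in> A"
    using cs l unfolding closed_chain_def by (meson mod_less_divisor nth_mem subsetD)
  ultimately have "succ_arc A (cs ! ?i) = cs ! (Suc ?i mod length cs)"
    using succ_arc_eqI[OF A] by metis
  then show ?case using Suc by (simp add: mod_Suc_eq)
qed

text \<open>Arc sets of closed chains are orbits of \<open>succ_arc\<close>. Two chains that share
  an arc therefore have the same arc set, which makes the closed curves disjoint.\<close>

lemma closed_chain_set:
  assumes A: "balanced A" and cs: "closed_chain A cs" and g: "\<gamma> \<in> set cs"
  shows "set cs = range (\<lambda>n. (succ_arc A ^^ n) \<gamma>)"
proof -
  obtain k where k: "k < length cs" "\<gamma> = cs ! k" using g by (auto simp: in_set_conv_nth)
  have eq: "(succ_arc A ^^ n) \<gamma> = cs ! ((k + n) mod length cs)" for n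
    using closed_chain_nth[OF A cs k(1)] k(2) by simp
  have "cs ! i \<in> range (\<lambda>n. (succ_arc A ^^ n) \<gamma>)" if "i < length cs" for i
  proof
    \<comment> \<open>Forward from position \<open>k\<close> to the end of the round, then
      \<open>i\<close> further; this exponent avoids a truncated subtraction when
      \<open>i < k\<close>.\<close>
    show "cs ! i = (succ_arc A ^^ (length cs - k + i)) \<gamma>"
      using k(1) that by (simp add: eq)
  qed simp
  moreover have "(succ_arc A ^^ n) \<gamma> \<in> set cs" for n
    unfolding eq using k(1) by (intro nth_mem mod_less_divisor) auto
  ultimately show ?thesis by (auto simp: in_set_conv_nth)
qed

text \<open>The orbit of \<gamma> in the finite family must repeat, and injectivity of
  \<open>succ_arc\<close> cancels the steps before the repetition, so the orbit returns to \<gamma>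
  itself.\<close>

lemma ex_closed_chain:
  assumes A: "balanced A" and g: "\<gamma> \<in> A"
  shows "\<exists>cs. closed_chain A cs \<and> \<gamma> \<in> set cs"
proof -
  let ?f = "\<lambda>n. (succ_arc A ^^ n) \<gamma>"
  have "finite (range ?f)"
    by (rule finite_subset[of _ A]) (use A funpow_succ_arc_in[OF A g] in \<open>auto simp: balanced_def\<close>)
  then have "\<not> inj ?f"
    using finite_imageD infinite_UNIV_nat by blast
  then obtain i j where ij: "i < j" "?f i = ?f j"
    unfolding inj_def by (metis linorder_neqE_nat)
  have "?f (j - i) = \<gamma>"
  proof (rule funpow_succ_arc_cancel[OF A funpow_succ_arc_in[OF A g] g])
    show "(succ_arc A ^^ i) (?f (j - i)) = ?f i"
      using ij by (simp flip: funpow_add[THEN fun_cong, unfolded o_def])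
  qed
  then have ex: "\<exists>n>0. ?f n = \<gamma>" using ij by (intro exI[of _ "j - i"]) simp
  \<comment> \<open>The least positive return time: a repetition within one round would give a
    shorter return, so the arcs of the round are distinct.\<close>
  define n where "n = (LEAST n. n > 0 \<and> ?f n = \<gamma>)"
  have n: "n > 0" "?f n = \<gamma>"
    using LeastI_ex[OF ex] unfolding n_def by auto
  have least: "?f m \<noteq> \<gamma>" if "0 < m" "m < n" for m
    using not_less_Least[of m "\<lambda>n. n > 0 \<and> ?f n = \<gamma>"] that unfolding n_def by blast
  define cs where "cs = map ?f [0..<n]"
  have "?f a \<noteq> ?f b" if "a < b" "b < n" for a b
  proof
    assume "?f a = ?f b"
    then have "(succ_arc A ^^ a) (?f (b - a)) = (succ_arc A ^^ a) \<gamma>"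
      using that by (simp flip: funpow_add[THEN fun_cong, unfolded o_def])
    then have "?f (b - a) = \<gamma>"
      by (rule funpow_succ_arc_cancel[OF A funpow_succ_arc_in[OF A g] g])
    then show False using least[of "b - a"] that by simp
  qed
  then have "inj_on ?f {0..<n}"
    by (intro linorder_inj_onI) auto
  then have "distinct cs"
    by (simp add: cs_def distinct_map)
  moreover have "pathfinish (cs ! i) = pathstart (cs ! (Suc i mod length cs))" if "i < length cs" for i
  proof -
    have "?f (Suc i mod n) = ?f (Suc i)"
    proof (cases "Suc i = n")
      case True
      then show ?thesis using n by (metis funpow_0 mod_self)
    next
      case False
      then show ?thesis using that by (simp add: cs_def)
    qed
    moreover have "Suc i mod n < n" using n by simp
    ultimately show ?thesis
      using that succ_arc(2)[OF A funpow_succ_arc_in[OF A g, of i]] by (simp add: cs_def)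
  qed
  moreover have "set cs \<subseteq> A" using funpow_succ_arc_in[OF A g] by (auto simp: cs_def)
  moreover have "cs \<noteq> []" using n by (simp add: cs_def)
  moreover have "\<gamma> \<in> set cs" using n by (auto simp: cs_def intro!: image_eqI[of _ _ 0])
  ultimately show ?thesis unfolding closed_chain_def by blast
qed

lemma closed_curves_partition:
  assumes A: "balanced A"
  shows "\<Union>(closed_curves A) = A" "disjoint (closed_curves A)" "\<And>C. C \<in> closed_curves A \<Longrightarrow> finite C"
proof -
  show "\<Union>(closed_curves A) = A"
  proof
    show "\<Union>(closed_curves A) \<subseteq> A" by (auto simp: closed_curves_def closed_chain_def)
    show "A \<subseteq> \<Union>(closed_curves A)"
      using ex_closed_chain[OF A] unfolding closed_curves_def by blast
  qed
  show "disjoint (closed_curves A)"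
  proof (rule disjointI)
    fix C D assume "C \<in> closed_curves A" "D \<in> closed_curves A" "C \<noteq> D"
    then obtain cs ds where *: "closed_chain A cs" "C = set cs" "closed_chain A ds" "D = set ds"
      by (auto simp: closed_curves_def)
    show "C \<inter> D = {}"
    proof (rule ccontr)
      assume "C \<inter> D \<noteq> {}"
      then obtain \<gamma> where g: "\<gamma> \<in> set cs" "\<gamma> \<in> set ds" using * by auto
      have "C = D"
        using closed_chain_set[OF A *(1) g(1)] closed_chain_set[OF A *(3) g(2)] *(2,4) by simp
      then show False using \<open>C \<noteq> D\<close> by simp
    qed
  qed
  show "finite C" if "C \<in> closed_curves A" for C
    using that by (auto simp: closed_curves_def)
qed

text \<open>One conjunction, because the induction step for the winding number uses the start and
  the image of the tail. The links are those of an open chain, so the induction can shorten the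
  list.\<close>

lemma concat_curves_join:
  assumes "cs \<noteq> []" "\<forall>c\<in>set cs. path c"
    "\<forall>i. Suc i < length cs \<longrightarrow> pathfinish (cs ! i) = pathstart (cs ! Suc i)"
  shows "path (concat_curves cs) \<and> pathstart (concat_curves cs) = pathstart (hd cs) \<and>
    pathfinish (concat_curves cs) = pathfinish (last cs) \<and>
    path_image (concat_curves cs) = \<Union>(path_image ` set cs) \<and>
    (z \<notin> \<Union>(path_image ` set cs) \<longrightarrow>
       winding_number (concat_curves cs) z = (\<Sum>c\<leftarrow>cs. winding_number c z))"
  using assms
proof (induction cs rule: concat_curves.induct)
  case (3 c d cs)
  have "pathfinish c = pathstart d" using "3.prems"(3) by (auto dest: spec[of _ 0])
  moreover have "\<forall>i. Suc i < length (d # cs) \<longrightarrow>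
      pathfinish ((d # cs) ! i) = pathstart ((d # cs) ! Suc i)"
    using "3.prems"(3) by (metis length_Cons Suc_less_eq nth_Cons_Suc)
  ultimately show ?case
    using 3 by (simp add: path_image_join winding_number_join)
qed auto

lemma traverse_props:
  assumes A: "balanced A" and C: "C \<in> closed_curves A"
  shows "path (traverse A C)" "pathfinish (traverse A C) = pathstart (traverse A C)"
    "path_image (traverse A C) = \<Union>(path_image ` C)"
    "z \<notin> \<Union>(path_image ` C) \<Longrightarrow> winding_number (traverse A C) z = (\<Sum>\<gamma>\<in>C. winding_number \<gamma> z)"
proof -
  define cs where "cs = (SOME cs. closed_chain A cs \<and> set cs = C)"
  have "\<exists>cs. closed_chain A cs \<and> set cs = C" using C by (auto simp: closed_curves_def)
  then have cs: "closed_chain A cs" "set cs = C"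
    using someI_ex[of "\<lambda>cs. closed_chain A cs \<and> set cs = C"] unfolding cs_def by auto
  have t: "traverse A C = concat_curves cs" by (simp add: traverse_def cs_def)
  have ne: "cs \<noteq> []" "distinct cs" using cs by (auto simp: closed_chain_def)
  have p: "\<forall>c\<in>set cs. path c" using cs A by (auto simp: closed_chain_def balanced_def)
  have link: "\<forall>i<length cs. pathfinish (cs ! i) = pathstart (cs ! (Suc i mod length cs))"
    using cs by (auto simp: closed_chain_def)
  then have "\<forall>i. Suc i < length cs \<longrightarrow> pathfinish (cs ! i) = pathstart (cs ! Suc i)"
    by (metis Suc_lessD mod_less)
  note * = concat_curves_join[OF ne(1) p this]
  have "pathfinish (last cs) = pathstart (hd cs)"
    using link[rule_format, of "length cs - 1"] ne by (simp add: last_conv_nth hd_conv_nth)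
  then show "path (traverse A C)" "pathfinish (traverse A C) = pathstart (traverse A C)"
    "path_image (traverse A C) = \<Union>(path_image ` C)"
    using * cs t by auto
  show "winding_number (traverse A C) z = (\<Sum>\<gamma>\<in>C. winding_number \<gamma> z)"
    if "z \<notin> \<Union>(path_image ` C)"
    using *[of z] that cs t sum_list_distinct_conv_sum_set[OF ne(2)] by simp
qed

lemma path_image_traverse_subset:
  assumes "balanced A" "C \<in> closed_curves A"
  shows "path_image (traverse A C) \<subseteq> \<Union>(path_image ` A)"
  unfolding traverse_props(3)[OF assms]
  by (rule Union_mono) (use assms closed_curves_partition(1) in blast)

text \<open>The bridge from the definition of the invariant, which groups arcs into closed curves,
  to a sum over single arcs, which sees only local changes.\<close>

lemma sum_closed_curves:
  assumes A: "balanced A" and z: "z \<notin> \<Union>(path_image ` A)"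
  shows "(\<Sum>C\<in>closed_curves A. winding_number (traverse A C) z) = total_winding A z"
proof -
  have "(\<Sum>C\<in>closed_curves A. winding_number (traverse A C) z)
      = (\<Sum>C\<in>closed_curves A. \<Sum>\<gamma>\<in>C. winding_number \<gamma> z)"
    using z closed_curves_partition(1)[OF A] by (intro sum.cong refl traverse_props(4)[OF A]) blast+
  also have "\<dots> = (\<Sum>\<gamma>\<in>\<Union>(closed_curves A). winding_number \<gamma> z)"
    using closed_curves_partition[OF A]
    by (subst sum.Union_disjoint) (auto simp: disjoint_def)
  finally show ?thesis
    using closed_curves_partition[OF A] by (simp add: total_winding_def)
qed

lemma total_winding_integer:
  assumes A: "balanced A" and z: "z \<notin> \<Union>(path_image ` A)"
  shows "total_winding A z \<in> \<int>"
  unfolding sum_closed_curves[OF assms, symmetric]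
proof (rule Ints_sum)
  fix C assume C: "C \<in> closed_curves A"
  have "z \<notin> path_image (traverse A C)"
    using z path_image_traverse_subset[OF A C] by blast
  then show "winding_number (traverse A C) z \<in> \<int>"
    using traverse_props(1,2)[OF A C] by (simp add: integer_winding_number)
qed

text \<open>The argument goes curve by curve: the winding of a single arc may vary along
  \<open>S\<close>, that of a closed curve is constant on a connected set avoiding it.\<close>

lemma total_winding_eq:
  assumes A: "balanced A" and S: "connected S" "S \<inter> \<Union>(path_image ` A) = {}" "w \<in> S" "z \<in> S"
  shows "total_winding A w = total_winding A z"
proof -
  have "w \<notin> \<Union>(path_image ` A)" "z \<notin> \<Union>(path_image ` A)" using S by auto
  moreover have "winding_number (traverse A C) w = winding_number (traverse A C) z"
    if C: "C \<in> closed_curves A" for C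
  proof (rule winding_number_eq)
    show "S \<inter> path_image (traverse A C) = {}"
      using S(2) path_image_traverse_subset[OF A C] by (meson disjoint_iff order_trans subsetD)
  qed (use traverse_props(1,2)[OF A C] S in auto)
  ultimately show ?thesis
    by (simp flip: sum_closed_curves[OF A])
qed

lemma total_winding_zero:
  assumes A: "balanced A" and X: "\<Union>(path_image ` A) \<subseteq> X" and z: "z \<notin> X"
    and null: "\<And>\<gamma>. path \<gamma> \<Longrightarrow> pathfinish \<gamma> = pathstart \<gamma> \<Longrightarrow> path_image \<gamma> \<subseteq> X \<Longrightarrow> winding_number \<gamma> z = 0"
  shows "total_winding A z = 0"
proof -
  have "z \<notin> \<Union>(path_image ` A)" using X z by auto
  moreover have "winding_number (traverse A C) z = 0" if C: "C \<in> closed_curves A" for C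
  proof (rule null)
    show "path_image (traverse A C) \<subseteq> X"
      using X path_image_traverse_subset[OF A C] by (rule order_trans[rotated])
  qed (use traverse_props(1,2)[OF A C] in auto)
  ultimately show ?thesis by (simp flip: sum_closed_curves[OF A])
qed

section \<open>Tilings as oriented planar graphs\<close>

definition parity :: "square \<Rightarrow> int" where
  "parity s = (fst s + snd s) mod 2"

definition over :: "square \<Rightarrow> int \<Rightarrow> cube" where
  "over s f = (fst s, snd s, f)"

definition adjacent :: "square \<Rightarrow> square \<Rightarrow> bool" where
  "adjacent s s' \<longleftrightarrow> \<bar>fst s' - fst s\<bar> + \<bar>snd s' - snd s\<bar> = 1"

text \<open>The white cube over \<open>s\<close> lies on floor \<open>parity s\<close>, so the pairs below are the segments from
  white to black, with the floor forgotten.\<close>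

definition steps :: "dimer set \<Rightarrow> (square \<times> square) set" where
  "steps t = {(s, s'). adjacent s s' \<and> {over s (parity s), over s' (parity s)} \<in> t}"

lemma steps_iff:
  "(s, s') \<in> steps t \<longleftrightarrow> adjacent s s' \<and> {over s (parity s), over s' (parity s)} \<in> t"
  by (simp add: steps_def)

definition seg :: "square \<times> square \<Rightarrow> curve" where
  "seg e = linepath (square_center (fst e)) (square_center (snd e))"

lemma over_eq_iff [simp]: "over s f = over s' f' \<longleftrightarrow> s = s' \<and> f = f'"
  by (auto simp: over_def prod_eq_iff)

lemma proj_over [simp]: "proj (over s f) = s"
  by (simp add: over_def)

lemma adjacent_commute: "adjacent s s' \<longleftrightarrow> adjacent s' s"
  by (auto simp: adjacent_def)

lemma not_adjacent_self [simp]: "\<not> adjacent s s"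
  by (simp add: adjacent_def)

lemma adjacent_iff:
  "adjacent (x, y) s \<longleftrightarrow> s = (x + 1, y) \<or> s = (x - 1, y) \<or> s = (x, y + 1) \<or> s = (x, y - 1)"
  by (cases s) (auto simp: adjacent_def)

lemma parity_range: "parity s = 0 \<or> parity s = 1"
  by (auto simp: parity_def)

lemma adjacent_parity: "adjacent s s' \<Longrightarrow> parity s' = 1 - parity s"
  by (cases s) (auto simp: adjacent_iff parity_def, presburger+)

lemma white_over: "f \<in> {0, 1} \<Longrightarrow> white (over s f) \<longleftrightarrow> f = parity s"
  by (auto simp: over_def parity_def)

lemma white_black_cube:
  assumes "white w" "\<not> white b"
  shows "white_cube {w, b} = w" "black_cube {w, b} = b"
  using assms unfolding white_cube_def black_cube_def by auto

text \<open>Exactly one of two adjacent squares has the floor of the dimer as its parity. Naming it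
  first lists the white cube first and makes the floor recoverable from the ordered pair of
  squares.\<close>

lemma dimer_cases:
  assumes "is_dimer d" and floors: "\<And>c. c \<in> d \<Longrightarrow> snd (snd c) \<in> {0, 1}"
  obtains (vertical) s where "d = {over s 0, over s 1}"
  | (horizontal) s s' where "adjacent s s'" "d = {over s (parity s), over s' (parity s)}"
proof -
  have horiz: thesis if "adjacent s s'" "d = {over s f, over s' f}" for s s' f
  proof -
    have f: "f = 0 \<or> f = 1" using floors[of "over s f"] that by (auto simp: over_def)
    show thesis
    proof (cases "f = parity s")
      case True
      then show thesis using horizontal that by blast
    next
      case False
      then have "f = parity s'"
        using f parity_range[of s] adjacent_parity[OF that(1)] by auto
      then show thesis using horizontal[of s' s] that adjacent_commute by (auto simp: insert_commute)
    qed
  qed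
  consider x y z where "d = {(x, y, z), (x + 1, y, z)}" | x y z where "d = {(x, y, z), (x, y + 1, z)}"
    | x y z where "d = {(x, y, z), (x, y, z + 1)}"
    using assms(1) unfolding is_dimer_def x_dimer_def y_dimer_def z_dimer_def by blast
  then show thesis
  proof cases
    case (1 x y z)
    then show thesis using horiz[of "(x, y)" "(x + 1, y)" z] by (simp add: adjacent_iff over_def)
  next
    case (2 x y z)
    then show thesis using horiz[of "(x, y)" "(x, y + 1)" z] by (simp add: adjacent_iff over_def)
  next
    case (3 x y z)
    then have "z = 0" using floors[of "(x, y, z)"] floors[of "(x, y, z + 1)"] by auto
    then show thesis using vertical[of "(x, y)"] 3 by (simp add: over_def)
  qed
qed

lemma z_dimer_over: "z_dimer {over s 0, over s 1}"
  unfolding z_dimer_def over_def by (metis add_0)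

lemma not_z_dimer_over: "s \<noteq> s' \<Longrightarrow> \<not> z_dimer {over s f, over s' f'}"
  unfolding z_dimer_def over_def by (auto simp: doubleton_eq_iff prod_eq_iff)

lemma is_dimer_over:
  assumes "adjacent s s'"
  shows "is_dimer {over s f, over s' f}"
proof -
  obtain x y where s: "s = (x, y)" by (cases s)
  have x: "x_dimer {(u, y, f), (u + 1, y, f)}" for u
    unfolding x_dimer_def by blast
  have y: "y_dimer {(x, v, f), (x, v + 1, f)}" for v
    unfolding y_dimer_def by blast
  show ?thesis
    using assms x[of x] x[of "x - 1"] y[of y] y[of "y - 1"]
    unfolding s adjacent_iff is_dimer_def over_def by (auto simp: insert_commute)
qed

lemma jewels_over: "s \<in> jewels t \<longleftrightarrow> {over s 0, over s 1} \<in> t"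
  by (cases s) (simp add: jewels_def over_def)

lemma square_center_eq_iff [simp]: "square_center s = square_center s' \<longleftrightarrow> s = s'"
  by (cases s; cases s') simp

declare square_center.simps [simp del]

lemma seg_simps [simp]:
  "pathstart (seg e) = square_center (fst e)" "pathfinish (seg e) = square_center (snd e)" "path (seg e)"
  by (simp_all add: seg_def)

lemma inj_seg: "inj seg"
  by (rule injI, metis prod_eqI seg_simps(1,2) square_center_eq_iff)

lemma white_square_parity: "white_square s \<longleftrightarrow> parity s = 0"
  by (cases s) (simp add: parity_def even_iff_mod_2_eq_zero)

text \<open>Weaker than a tiling of a two-story region on purpose: the six cubes covered by a trit
  triple, with any tiling of them, are an instance too.\<close>

locale floor_tiling =
  fixes R :: "cube set" and t :: "dimer set"
  assumes finite_R: "finite R" and floors: "c \<in> R \<Longrightarrow> snd (snd c) \<in> {0, 1}"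
    and tiling: "is_tiling R t"
begin

lemma dimer_unique: "d \<in> t \<Longrightarrow> d' \<in> t \<Longrightarrow> c \<in> d \<Longrightarrow> c \<in> d' \<Longrightarrow> d = d'"
  using tiling unfolding is_tiling_def disjoint_def by blast

lemma dimer_subset: "d \<in> t \<Longrightarrow> d \<subseteq> R"
  using tiling unfolding is_tiling_def by blast

lemma tile_cases:
  assumes "d \<in> t"
  obtains (vertical) s where "d = {over s 0, over s 1}"
  | (horizontal) s s' where "adjacent s s'" "d = {over s (parity s), over s' (parity s)}"
  using assms dimer_cases[of d] floors dimer_subset tiling unfolding is_tiling_def
  by (metis subsetD)

lemma steps_out_unique: "(s, a) \<in> steps t \<Longrightarrow> (s, b) \<in> steps t \<Longrightarrow> a = b"
  using dimer_unique[of "{over s (parity s), over a (parity s)}" "{over s (parity s), over b (parity s)}" "over s (parity s)"]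
  by (auto simp: steps_def doubleton_eq_iff)

text \<open>All predecessors of \<open>s\<close> have the opposite parity, so every segment into
  \<open>s\<close> uses the one black cube over \<open>s\<close>.\<close>

lemma steps_in_unique:
  assumes "(a, s) \<in> steps t" "(b, s) \<in> steps t"
  shows "a = b"
proof -
  have "parity a = parity b" using assms by (auto simp: steps_def dest!: adjacent_parity)
  then show ?thesis
    using assms dimer_unique[of "{over a (parity a), over s (parity a)}" "{over b (parity b), over s (parity b)}" "over s (parity b)"]
    by (auto simp: steps_def doubleton_eq_iff)
qed

lemma jewel_no_step:
  assumes "s \<in> jewels t"
  shows "(s, a) \<notin> steps t" "(a, s) \<notin> steps t"
proof -
  have j: "{over s 0, over s 1} \<in> t" using assms by (simp add: jewels_over)
  show "(s, a) \<notin> steps t"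
    using dimer_unique[OF j, of "{over s (parity s), over a (parity s)}" "over s (parity s)"] parity_range[of s]
    by (auto simp: steps_def doubleton_eq_iff)
  show "(a, s) \<notin> steps t"
    using dimer_unique[OF j, of "{over a (parity a), over s (parity a)}" "over s (parity a)"] parity_range[of a]
    by (auto simp: steps_def doubleton_eq_iff)
qed

lemma step_in_R:
  assumes "(s, s') \<in> steps t"
  shows "over s (parity s) \<in> R" "over s' (1 - parity s') \<in> R"
  using assms dimer_subset adjacent_parity[of s s'] by (auto simp: steps_def)

lemma ex_dimer: "c \<in> R \<Longrightarrow> \<exists>d\<in>t. c \<in> d"
  using tiling unfolding is_tiling_def by blast

lemma ex_step_out:
  assumes "over s (parity s) \<in> R" "s \<notin> jewels t"
  shows "\<exists>s'. (s, s') \<in> steps t"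
proof -
  obtain d where d: "d \<in> t" "over s (parity s) \<in> d" using ex_dimer[OF assms(1)] by blast
  from d(1) show ?thesis
  proof (cases rule: tile_cases)
    case (vertical s1)
    then show ?thesis using d assms(2) by (auto simp: jewels_over)
  next
    case (horizontal a b)
    then have "s = a" using d(2) adjacent_parity[of a b] parity_range[of a] by auto
    then show ?thesis using d horizontal unfolding steps_iff by blast
  qed
qed

lemma ex_step_in:
  assumes "over s (1 - parity s) \<in> R" "s \<notin> jewels t"
  shows "\<exists>s'. (s', s) \<in> steps t"
proof -
  obtain d where d: "d \<in> t" "over s (1 - parity s) \<in> d" using ex_dimer[OF assms(1)] by blast
  from d(1) show ?thesis
  proof (cases rule: tile_cases)
    case (vertical s1)
    then show ?thesis using d assms(2) by (auto simp: jewels_over)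
  next
    case (horizontal a b)
    then have "s = b" using d(2) adjacent_parity[of a b] parity_range[of a] by auto
    then show ?thesis using d horizontal unfolding steps_iff by blast
  qed
qed

lemma steps_subset: "steps t \<subseteq> proj ` R \<times> proj ` R"
  using step_in_R by (auto simp: image_iff) (metis proj_over)+

lemma finite_steps: "finite (steps t)"
  using finite_subset[OF steps_subset] finite_R by blast

lemma jewels_subset: "jewels t \<subseteq> shadow R 0 \<inter> shadow R 1"
  using dimer_subset by (fastforce simp: jewels_def shadow_def)

lemma finite_jewels: "finite (jewels t)"
proof (rule finite_subset)
  show "jewels t \<subseteq> proj ` R" using dimer_subset by (force simp: jewels_def image_iff)
qed (simp add: finite_R)

lemma dimer_curves_eq: "dimer_curve ` {d \<in> t. \<not> z_dimer d} = seg ` steps t"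
proof -
  have curve: "dimer_curve {over a (parity a), over b (parity a)} = seg (a, b)" if "adjacent a b" for a b
  proof -
    have "white (over a (parity a))" "\<not> white (over b (parity a))"
      using white_over[of "parity a"] parity_range[of a] adjacent_parity[OF that] by auto
    then show ?thesis
      by (simp add: dimer_curve_def white_black_cube seg_def)
  qed
  have "\<exists>e\<in>steps t. dimer_curve d = seg e" if "d \<in> t" "\<not> z_dimer d" for d
    using that(1)
  proof (cases rule: tile_cases)
    case (vertical s)
    then show ?thesis using that z_dimer_over by blast
  next
    case (horizontal a b)
    then have "(a, b) \<in> steps t" "dimer_curve d = seg (a, b)"
      using that curve by (auto simp: steps_def)
    then show ?thesis by blast
  qed
  moreover have "seg e \<in> dimer_curve ` {d \<in> t. \<not> z_dimer d}" if est: "e \<in> steps t" for e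
  proof -
    obtain a b where e: "e = (a, b)" "adjacent a b" "{over a (parity a), over b (parity a)} \<in> t"
      using est by (metis steps_iff surj_pair)
    then show ?thesis
      using curve[OF e(2)] not_z_dimer_over[of a b] not_adjacent_self[of a]
      by (intro image_eqI[where x = "{over a (parity a), over b (parity a)}"]) (simp, metis (mono_tags, lifting) mem_Collect_eq)
  qed
  ultimately show ?thesis by blast
qed

lemma arcs_eq: "arcs G t = seg ` steps t \<union> G"
  by (simp add: arcs_def dimer_curves_eq)

section \<open>Balance of starts and ends at jewels and holes\<close>

lemma fst_steps: "fst ` steps t = {s. over s (parity s) \<in> R} - jewels t"
proof (intro equalityI subsetI)
  fix s assume "s \<in> fst ` steps t"
  then show "s \<in> {s. over s (parity s) \<in> R} - jewels t"
    using step_in_R jewel_no_step by fastforce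
next
  fix s assume "s \<in> {s. over s (parity s) \<in> R} - jewels t"
  then show "s \<in> fst ` steps t" using ex_step_out[of s] by force
qed

lemma snd_steps: "snd ` steps t = {s. over s (1 - parity s) \<in> R} - jewels t"
proof (intro equalityI subsetI)
  fix s assume "s \<in> snd ` steps t"
  then show "s \<in> {s. over s (1 - parity s) \<in> R} - jewels t"
    using step_in_R jewel_no_step by fastforce
next
  fix s assume "s \<in> {s. over s (1 - parity s) \<in> R} - jewels t"
  then show "s \<in> snd ` steps t" using ex_step_in[of s] by force
qed

lemma in_R_iff: "c \<in> R \<longleftrightarrow> (\<exists>s. c = over s (parity s) \<and> over s (parity s) \<in> R)
    \<or> (\<exists>s. c = over s (1 - parity s) \<and> over s (1 - parity s) \<in> R)"
proof -
  obtain x y z where c: "c = (x, y, z)" by (cases c)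
  then have "c = over (x, y) z" by (simp add: over_def)
  moreover have "c \<in> R \<Longrightarrow> z = parity (x, y) \<or> z = 1 - parity (x, y)"
    using floors[of c] parity_range[of "(x, y)"] c by auto
  ultimately show ?thesis by auto
qed

lemma initial_holes_eq:
  "initial_holes R = {s. over s (parity s) \<in> R \<and> over s (1 - parity s) \<notin> R}"
proof -
  have h: "s \<in> holes R \<longleftrightarrow> (over s (parity s) \<in> R \<longleftrightarrow> over s (1 - parity s) \<notin> R)" for s
    using parity_range[of s] by (cases s) (auto simp: holes_def shadow_def over_def)
  have cR: "(\<exists>c\<in>R. proj c = s \<and> Q c) \<longleftrightarrow> over s (parity s) \<in> R \<and> Q (over s (parity s)) \<or>
      over s (1 - parity s) \<in> R \<and> Q (over s (1 - parity s))" for s Q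
    using in_R_iff proj_over by metis
  have "(\<exists>c\<in>R. proj c = s \<and> white c) \<longleftrightarrow> over s (parity s) \<in> R" for s
    unfolding cR using parity_range[of s] white_over[of "parity s" s] white_over[of "1 - parity s" s]
    by auto
  then show ?thesis by (auto simp: initial_holes_def h)
qed

lemma terminal_holes_eq:
  "terminal_holes R = {s. over s (1 - parity s) \<in> R \<and> over s (parity s) \<notin> R}"
proof -
  have h: "s \<in> holes R \<longleftrightarrow> (over s (parity s) \<in> R \<longleftrightarrow> over s (1 - parity s) \<notin> R)" for s
    using parity_range[of s] by (cases s) (auto simp: holes_def shadow_def over_def)
  have cR: "(\<exists>c\<in>R. proj c = s \<and> Q c) \<longleftrightarrow> over s (parity s) \<in> R \<and> Q (over s (parity s)) \<or>
      over s (1 - parity s) \<in> R \<and> Q (over s (1 - parity s))" for s Q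
    using in_R_iff proj_over by metis
  have "(\<exists>c\<in>R. proj c = s \<and> \<not> white c) \<longleftrightarrow> over s (1 - parity s) \<in> R" for s
    unfolding cR using parity_range[of s] white_over[of "parity s" s] white_over[of "1 - parity s" s]
    by auto
  then show ?thesis by (auto simp: terminal_holes_def h)
qed

lemma jewel_in_R: "s \<in> jewels t \<Longrightarrow> over s (parity s) \<in> R \<and> over s (1 - parity s) \<in> R"
  using dimer_subset[of "{over s 0, over s 1}"] parity_range[of s] by (auto simp: jewels_over)

lemma ghosts_finite: "ghost_curves R G \<Longrightarrow> finite G"
proof -
  assume "ghost_curves R G"
  then have "bij_betw pathstart G (square_center ` terminal_holes R)" by (simp add: ghost_curves_def)
  moreover have "finite (terminal_holes R)"
  proof (rule finite_subset)
    show "terminal_holes R \<subseteq> proj ` R" unfolding terminal_holes_def by blast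
  qed (simp add: finite_R)
  ultimately show "finite G" using bij_betw_finite by blast
qed

text \<open>A segment starts over a white cube, a ghost curve at a hole without one. As
  \<open>arcs\<close> is a union of sets, a coincidence would lose a summand.\<close>

lemma seg_not_ghost:
  assumes "ghost_curves R G"
  shows "seg ` steps t \<inter> G = {}"
proof -
  have G: "pathstart ` G = square_center ` terminal_holes R"
    using assms by (auto simp: ghost_curves_def bij_betw_def)
  have "seg e \<notin> G" if "e \<in> steps t" for e
  proof
    assume "seg e \<in> G"
    then have "square_center (fst e) \<in> square_center ` terminal_holes R"
      using G by (metis imageI seg_simps(1))
    then have "fst e \<in> terminal_holes R" by auto
    moreover have "over (fst e) (parity (fst e)) \<in> R" using step_in_R[of "fst e" "snd e"] that by simp
    ultimately show False by (simp add: terminal_holes_eq)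
  qed
  then show ?thesis by blast
qed

lemma balanced_arcs:
  assumes "ghost_curves R G"
  shows "balanced (arcs G t)"
proof -
  have G: "pathstart ` G = square_center ` terminal_holes R" "inj_on pathstart G"
    "pathfinish ` G = square_center ` initial_holes R" "inj_on pathfinish G" "\<forall>\<gamma>\<in>G. path \<gamma>"
    using assms by (auto simp: ghost_curves_def bij_betw_def)
  have s: "pathstart ` seg ` steps t = square_center ` ({s. over s (parity s) \<in> R} - jewels t)"
    "pathfinish ` seg ` steps t = square_center ` ({s. over s (1 - parity s) \<in> R} - jewels t)"
    by (auto simp: image_image simp flip: fst_steps snd_steps)
  \<comment> \<open>Starts and ends are both the centers of all squares of the two shadows except
    the jewels: a ghost curve supplies the missing start at a hole with only a black cube and the
    missing end at a hole with only a white one.\<close>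
  have "pathstart ` (seg ` steps t \<union> G) = square_center `
      (({s. over s (parity s) \<in> R} - jewels t) \<union> {s. over s (1 - parity s) \<in> R \<and> over s (parity s) \<notin> R})"
    unfolding image_Un s G terminal_holes_eq ..
  also have "\<dots> = square_center `
      (({s. over s (1 - parity s) \<in> R} - jewels t) \<union> {s. over s (parity s) \<in> R \<and> over s (1 - parity s) \<notin> R})"
    using jewel_in_R by (intro arg_cong[where f = "image square_center"]) blast
  also have "\<dots> = pathfinish ` (seg ` steps t \<union> G)"
    unfolding image_Un s G initial_holes_eq ..
  finally have eq: "pathstart ` (seg ` steps t \<union> G) = pathfinish ` (seg ` steps t \<union> G)" .
  have "inj_on pathstart (seg ` steps t)"
    using steps_out_unique by (fastforce intro!: inj_onI)
  moreover have "inj_on pathfinish (seg ` steps t)"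
    using steps_in_unique by (fastforce intro!: inj_onI)
  moreover have "pathstart ` seg ` steps t \<inter> pathstart ` G = {}"
    unfolding s G terminal_holes_eq by auto
  moreover have "pathfinish ` seg ` steps t \<inter> pathfinish ` G = {}"
    unfolding s G initial_holes_eq by auto
  ultimately have "inj_on pathstart (seg ` steps t \<union> G)" "inj_on pathfinish (seg ` steps t \<union> G)"
    using G unfolding inj_on_Un by blast+
  then show ?thesis
    unfolding balanced_def arcs_eq using eq finite_steps ghosts_finite[OF assms] G by auto
qed

lemma total_winding_arcs:
  assumes "ghost_curves R G"
  shows "total_winding (arcs G t) z =
    (\<Sum>e\<in>steps t. winding_number (seg e) z) + (\<Sum>g\<in>G. winding_number g z)"
proof -
  have "total_winding (arcs G t) z =
      (\<Sum>e\<in>seg ` steps t. winding_number e z) + (\<Sum>g\<in>G. winding_number g z)"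
    unfolding total_winding_def arcs_eq
    using seg_not_ghost[OF assms] finite_steps ghosts_finite[OF assms] by (simp add: sum.union_disjoint)
  then show ?thesis by (simp add: sum.reindex inj_on_subset[OF inj_seg])
qed

end

section \<open>Winding of grid segments\<close>

text \<open>The upper right corner of the square \<open>p\<close>, which is the center of the block
  of four squares whose lower left one is \<open>p\<close>. So \<open>p\<close> also serves as the
  name of that block.\<close>

definition corner :: "square \<Rightarrow> complex" where
  "corner p = Complex (of_int (fst p) + 1) (of_int (snd p) + 1)"

definition wind :: "(square \<times> square) set \<Rightarrow> complex \<Rightarrow> complex" where
  "wind E z = (\<Sum>e\<in>E. winding_number (seg e) z)"

lemma total_winding_seg: "total_winding (seg ` E) z = wind E z"
  by (simp add: total_winding_def wind_def sum.reindex inj_on_subset[OF inj_seg])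

lemma seg_image_horizontal:
  "z \<in> path_image (seg ((x, y), (x + 1, y))) \<longleftrightarrow>
     Im z = of_int y + 1/2 \<and> of_int x + 1/2 \<le> Re z \<and> Re z \<le> of_int x + 3/2"
  by (simp add: seg_def square_center.simps closed_segment_same_Im closed_segment_eq_real_ivl) auto

lemma seg_image_vertical:
  "z \<in> path_image (seg ((x, y), (x, y + 1))) \<longleftrightarrow>
     Re z = of_int x + 1/2 \<and> of_int y + 1/2 \<le> Im z \<and> Im z \<le> of_int y + 3/2"
  by (simp add: seg_def square_center.simps closed_segment_same_Re closed_segment_eq_real_ivl) auto

lemma reversepath_seg: "reversepath (seg (a, b)) = seg (b, a)"
  by (simp add: seg_def)

lemma path_image_seg_commute: "path_image (seg (a, b)) = path_image (seg (b, a))"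
  by (metis path_image_reversepath reversepath_seg)

lemma winding_seg_reverse:
  "z \<notin> path_image (seg (a, b)) \<Longrightarrow> winding_number (seg (b, a)) z = - winding_number (seg (a, b)) z"
  by (metis reversepath_seg seg_simps(3) winding_number_reversepath)

lemma adjacent_cases:
  assumes "adjacent a b"
  obtains x y where "{a, b} = {(x, y), (x + 1, y)}" "path_image (seg (a, b)) = path_image (seg ((x, y), (x + 1, y)))"
  | x y where "{a, b} = {(x, y), (x, y + 1)}" "path_image (seg (a, b)) = path_image (seg ((x, y), (x, y + 1)))"
proof -
  obtain x y where a: "a = (x, y)" by (cases a)
  consider "b = (x + 1, y)" | "b = (x - 1, y)" | "b = (x, y + 1)" | "b = (x, y - 1)"
    using assms unfolding a adjacent_iff by blast
  then show thesis
  proof cases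
    case 1
    then show thesis using that(1)[of x y] a by simp
  next
    case 2
    then show thesis using that(1)[of "x - 1" y] a path_image_seg_commute[of a b] by auto
  next
    case 3
    then show thesis using that(2)[of x y] a by simp
  next
    case 4
    then show thesis using that(2)[of x "y - 1"] a path_image_seg_commute[of a b] by auto
  qed
qed

lemma real_int_half:
  "real_of_int x + 1 \<noteq> real_of_int y + 1/2"
proof
  assume "real_of_int x + 1 = real_of_int y + 1/2"
  then have "real_of_int (2 * x + 2) = real_of_int (2 * y + 1)" by simp
  then show False unfolding of_int_eq_iff by presburger
qed

text \<open>Each segment runs on a line with a half-integral coordinate, while corners have integral
  coordinates.\<close>

lemma corner_notin_seg: "adjacent a b \<Longrightarrow> corner p \<notin> path_image (seg (a, b))"
  by (erule adjacent_cases)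
    (simp_all add: seg_image_horizontal seg_image_vertical corner_def real_int_half)

lemma center_notin_seg:
  assumes "adjacent a b" "s \<noteq> a" "s \<noteq> b"
  shows "square_center s \<notin> path_image (seg (a, b))"
proof -
  obtain u v where s: "s = (u, v)" by (cases s)
  have le: "real_of_int i + 1/2 \<le> real_of_int j + 1/2 \<longleftrightarrow> i \<le> j"
    "real_of_int i + 1/2 \<le> real_of_int j + 3/2 \<longleftrightarrow> i \<le> j + 1" for i j by linarith+
  from assms(1) show ?thesis
  proof (cases rule: adjacent_cases)
    case (1 x y)
    then have "\<not> (v = y \<and> x \<le> u \<and> u \<le> x + 1)" using assms(2,3) s by (auto simp: doubleton_eq_iff)
    then show ?thesis using 1 by (simp add: seg_image_horizontal s square_center.simps le)
  next
    case (2 x y)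
    then have "\<not> (u = x \<and> y \<le> v \<and> v \<le> y + 1)" using assms(2,3) s by (auto simp: doubleton_eq_iff)
    then show ?thesis using 2 by (simp add: seg_image_vertical s square_center.simps le)
  qed
qed

section \<open>Unit loops around a lattice point\<close>

definition ccw :: "square \<Rightarrow> square \<Rightarrow> square \<Rightarrow> square \<Rightarrow> square \<Rightarrow> bool" where
  "ccw p a b c d \<longleftrightarrow> (let (x, y) = p in (a, b, c, d) \<in>
     {((x, y), (x + 1, y), (x + 1, y + 1), (x, y + 1)), ((x + 1, y), (x + 1, y + 1), (x, y + 1), (x, y)),
      ((x + 1, y + 1), (x, y + 1), (x, y), (x + 1, y)), ((x, y + 1), (x, y), (x + 1, y), (x + 1, y + 1))})"

text \<open>The squares \<open>a, b, c, d\<close> surround the lattice point \<open>corner p\<close>, counterclockwise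
  if \<open>\<epsilon> = 1\<close> and clockwise if \<open>\<epsilon> = - 1\<close>.\<close>

definition around :: "int \<Rightarrow> square \<Rightarrow> square \<Rightarrow> square \<Rightarrow> square \<Rightarrow> square \<Rightarrow> bool" where
  "around \<epsilon> p a b c d \<longleftrightarrow> \<epsilon> = 1 \<and> ccw p a b c d \<or> \<epsilon> = - 1 \<and> ccw p d c b a"

lemma ccw_rotate: "ccw p a b c d \<Longrightarrow> ccw p b c d a"
  by (auto simp: ccw_def split: prod.splits)

lemma around_rotate: "around \<epsilon> p a b c d \<Longrightarrow> around \<epsilon> p b c d a"
  using ccw_rotate unfolding around_def by blast

lemma around_reverse: "around \<epsilon> p a b c d \<Longrightarrow> around (- \<epsilon>) p d c b a"
  unfolding around_def by auto

lemma ccw_adjacent: "ccw p a b c d \<Longrightarrow> adjacent a b"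
  by (auto simp: ccw_def adjacent_iff split: prod.splits)

lemma around_adjacent:
  assumes "around \<epsilon> p a b c d"
  shows "adjacent a b" "adjacent b c" "adjacent c d" "adjacent d a"
  using assms ccw_adjacent ccw_rotate unfolding around_def by (metis adjacent_commute)+

lemma ccw_distinct: "ccw p a b c d \<Longrightarrow> distinct [a, b, c, d]"
  by (auto simp: ccw_def split: prod.splits)

lemma around_distinct: "around \<epsilon> p a b c d \<Longrightarrow> distinct [a, b, c, d]"
  using ccw_distinct unfolding around_def by fastforce

lemma around_set: "around \<epsilon> p a b c d \<Longrightarrow> {a, b, c, d} = {fst p, fst p + 1} \<times> {snd p, snd p + 1}"
  by (cases p) (auto simp: around_def ccw_def)

text \<open>A sum over four open arcs instead of one closed path: it is invariant under rotation of
  the squares, and two of its summands can be traded for the other two when a move reroutes a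
  path.\<close>

definition loop_winding :: "square \<Rightarrow> square \<Rightarrow> square \<Rightarrow> square \<Rightarrow> complex \<Rightarrow> complex" where
  "loop_winding a b c d z = winding_number (seg (a, b)) z + winding_number (seg (b, c)) z
     + winding_number (seg (c, d)) z + winding_number (seg (d, a)) z"

lemma loop_winding_rectpath:
  assumes "z \<notin> path_image (rectpath (square_center (x, y)) (square_center (x + 1, y + 1)))"
  shows "loop_winding (x, y) (x + 1, y) (x + 1, y + 1) (x, y + 1) z =
    winding_number (rectpath (square_center (x, y)) (square_center (x + 1, y + 1))) z"
proof -
  have eq: "rectpath (square_center (x, y)) (square_center (x + 1, y + 1)) =
      seg ((x, y), (x + 1, y)) +++ seg ((x + 1, y), (x + 1, y + 1)) +++
      seg ((x + 1, y + 1), (x, y + 1)) +++ seg ((x, y + 1), (x, y))"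
    by (simp add: rectpath_def seg_def square_center.simps Let_def)
  have "z \<notin> path_image (seg ((x, y), (x + 1, y)))" "z \<notin> path_image (seg ((x + 1, y), (x + 1, y + 1)))"
      "z \<notin> path_image (seg ((x + 1, y + 1), (x, y + 1)))" "z \<notin> path_image (seg ((x, y + 1), (x, y)))"
    using assms unfolding eq by (auto simp: path_image_join)
  then show ?thesis
    unfolding eq by (simp add: winding_number_join path_image_join loop_winding_def)
qed

lemma loop_winding_ccw:
  assumes "ccw p a b c d" "z \<notin> path_image (rectpath (square_center p) (square_center (fst p + 1, snd p + 1)))"
  shows "loop_winding a b c d z = winding_number (rectpath (square_center p) (square_center (fst p + 1, snd p + 1))) z"
  using assms(1) loop_winding_rectpath[of z "fst p" "snd p"] assms(2)
  by (cases p) (auto simp: ccw_def loop_winding_def add_ac)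

lemma loop_winding_reverse:
  assumes "z \<notin> path_image (seg (a, b))" "z \<notin> path_image (seg (b, c))"
    "z \<notin> path_image (seg (c, d))" "z \<notin> path_image (seg (d, a))"
  shows "loop_winding d c b a z = - loop_winding a b c d z"
  using assms by (simp add: loop_winding_def winding_seg_reverse)

text \<open>The loop is a rectangle with half-integral sides: \<open>corner p\<close> lies in its
  open box, and every other lattice point outside its closed box.\<close>

lemma loop_winding_corner:
  assumes "around \<epsilon> p a b c d"
  shows "loop_winding a b c d (corner q) = (if q = p then of_int \<epsilon> else 0)"
proof -
  let ?r = "rectpath (square_center p) (square_center (fst p + 1, snd p + 1))"
  obtain x y u v where pq: "p = (x, y)" "q = (u, v)" by (cases p, cases q)
  have le: "real_of_int i + 1/2 \<le> real_of_int j + 1 \<longleftrightarrow> i \<le> j"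
    "real_of_int i + 1 \<le> real_of_int j + 3/2 \<longleftrightarrow> i \<le> j"
    "real_of_int i + 1/2 < real_of_int j + 1 \<longleftrightarrow> i \<le> j"
    "real_of_int i + 1 < real_of_int j + 3/2 \<longleftrightarrow> i \<le> j" for i j by linarith+
  have "corner q \<notin> path_image ?r \<and> winding_number ?r (corner q) = (if q = p then 1 else 0)"
  proof (cases "q = p")
    case True
    then have "corner q \<in> box (square_center p) (square_center (fst p + 1, snd p + 1))"
      by (simp add: in_box_complex_iff pq corner_def square_center.simps)
    then show ?thesis
      using True path_image_rectpath_inter_box[of "square_center p" "square_center (fst p + 1, snd p + 1)"]
      by (auto simp: winding_number_rectpath pq square_center.simps)
  next
    case False
    then have "corner q \<notin> cbox (square_center p) (square_center (fst p + 1, snd p + 1))"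
      by (auto simp: in_cbox_complex_iff pq corner_def square_center.simps le add.commute)
    then show ?thesis
      using False path_image_rectpath_subset_cbox[of "square_center p" "square_center (fst p + 1, snd p + 1)"]
      by (auto simp: winding_number_rectpath_outside pq square_center.simps)
  qed
  then have *: "loop_winding a' b' c' d' (corner q) = (if q = p then 1 else 0)" if "ccw p a' b' c' d'" for a' b' c' d'
    using loop_winding_ccw[OF that] by simp
  from assms consider "\<epsilon> = 1" "ccw p a b c d" | "\<epsilon> = - 1" "ccw p d c b a"
    unfolding around_def by blast
  then show ?thesis
  proof cases
    case 1
    then show ?thesis using * by auto
  next
    case 2
    then show ?thesis
      using *[OF 2(2)] around_adjacent[OF assms] loop_winding_reverse[of "corner q" d c b a]
      by (auto simp: corner_notin_seg adjacent_commute)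
  qed
qed

lemma loop_winding_center:
  assumes "around \<epsilon> p a b c d" "s \<notin> {a, b, c, d}"
  shows "loop_winding a b c d (square_center s) = 0"
proof -
  let ?r = "rectpath (square_center p) (square_center (fst p + 1, snd p + 1))"
  obtain x y u v where pq: "p = (x, y)" "s = (u, v)" by (cases p, cases s)
  have "\<not> (x \<le> u \<and> u \<le> x + 1 \<and> y \<le> v \<and> v \<le> y + 1)"
    using assms(2) unfolding around_set[OF assms(1)] by (auto simp: pq)
  then have out: "square_center s \<notin> cbox (square_center p) (square_center (fst p + 1, snd p + 1))"
    by (auto simp: in_cbox_complex_iff pq square_center.simps)
  have "square_center s \<notin> path_image ?r \<and> winding_number ?r (square_center s) = 0"
    using out path_image_rectpath_subset_cbox[of "square_center p" "square_center (fst p + 1, snd p + 1)"]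
      winding_number_rectpath_outside[OF _ _ out]
    by (auto simp: pq square_center.simps)
  then have *: "loop_winding a' b' c' d' (square_center s) = 0" if "ccw p a' b' c' d'" for a' b' c' d'
    using loop_winding_ccw[OF that] by simp
  from assms consider "\<epsilon> = 1" "ccw p a b c d" | "\<epsilon> = - 1" "ccw p d c b a"
    unfolding around_def by blast
  then show ?thesis
  proof cases
    case 1
    then show ?thesis using * by auto
  next
    case 2
    then show ?thesis
      using *[OF 2(2)] around_adjacent[OF assms(1)] loop_winding_reverse[of "square_center s" d c b a] assms(2)
      by (auto simp: center_notin_seg adjacent_commute)
  qed
qed

text \<open>A half diagonal starts on half-integral lines and moves both coordinates by at most 1/2,
  so it could meet a segment only at its start, the center of \<open>s\<close>.\<close>

lemma diagonal_avoids_seg: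
  assumes "adjacent a b" "s \<noteq> a" "s \<noteq> b" "s \<in> {fst p, fst p + 1} \<times> {snd p, snd p + 1}"
  shows "closed_segment (square_center s) (corner p) \<inter> path_image (seg (a, b)) = {}"
proof (rule ccontr)
  assume "\<not> ?thesis"
  then obtain z where z: "z \<in> closed_segment (square_center s) (corner p)" "z \<in> path_image (seg (a, b))"
    by blast
  obtain u v where s: "s = (u, v)" by (cases s)
  obtain k where k: "0 \<le> k" "k \<le> 1" "z = (1 - k) *\<^sub>R square_center s + k *\<^sub>R corner p"
    using z(1) by (auto simp: in_segment)
  \<comment> \<open>The signs \<open>i\<close> and \<open>j\<close> give the direction in which the
    diagonal leaves the center of \<open>s\<close>; they cover the four positions of
    \<open>s\<close> in the block at once.\<close>
  obtain i j where ij: "(i = 1 \<or> i = - 1)" "(j = 1 \<or> j = - 1)"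
    "Re (corner p) = of_int u + 1/2 + i / 2" "Im (corner p) = of_int v + 1/2 + j / 2"
  proof
    show "(2 * of_int (fst p - u) + 1 = (1::real) \<or> 2 * of_int (fst p - u) + 1 = (- 1::real))"
      "(2 * of_int (snd p - v) + 1 = (1::real) \<or> 2 * of_int (snd p - v) + 1 = (- 1::real))"
      using assms(4) by (auto simp: s)
  qed (simp_all add: corner_def field_simps)
  have re: "Re z = of_int u + 1/2 + k * i / 2" and im: "Im z = of_int v + 1/2 + k * j / 2"
    unfolding k(3) by (simp_all add: ij s square_center.simps algebra_simps add_divide_distrib)
  have half: "k = 0 \<and> m = n" if "real_of_int m + 1/2 + k * l / 2 = of_int n + 1/2" "l = 1 \<or> l = - 1" for m n l
  proof -
    have "k * l / 2 = of_int (n - m)" using that(1) by simp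
    moreover have "\<bar>k * l / 2\<bar> \<le> 1/2" using k that(2) by auto
    ultimately have "\<bar>of_int (n - m) :: real\<bar> < 1" by simp
    then have "n = m" by linarith
    then show ?thesis using that by auto
  qed
  have "k = 0"
    using assms(1)
  proof (cases rule: adjacent_cases)
    case (1 x y)
    then show ?thesis using z(2) im half[of v j y] ij by (auto simp: seg_image_horizontal)
  next
    case (2 x y)
    then show ?thesis using z(2) re half[of u i x] ij by (auto simp: seg_image_vertical)
  qed
  then have "z = square_center s" using k(3) by simp
  then show False using center_notin_seg[OF assms(1-3)] z(2) by simp
qed

section \<open>Jumps of the winding across grid edges\<close>

lemma balanced_seg_iff:
  "balanced (seg ` E) \<longleftrightarrow> finite E \<and> inj_on fst E \<and> inj_on snd E \<and> fst ` E = snd ` E"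
proof -
  have i: "inj_on seg E" using inj_seg by (rule inj_on_subset) simp
  have c: "inj square_center" by (simp add: inj_def)
  have "inj_on pathstart (seg ` E) \<longleftrightarrow> inj_on (square_center \<circ> fst) E"
    by (simp add: comp_inj_on_iff[OF i] o_def)
  also have "\<dots> \<longleftrightarrow> inj_on fst E" by (auto simp: inj_on_def)
  finally have s: "inj_on pathstart (seg ` E) \<longleftrightarrow> inj_on fst E" .
  have "inj_on pathfinish (seg ` E) \<longleftrightarrow> inj_on (square_center \<circ> snd) E"
    by (simp add: comp_inj_on_iff[OF i] o_def)
  also have "\<dots> \<longleftrightarrow> inj_on snd E" by (auto simp: inj_on_def)
  finally have f: "inj_on pathfinish (seg ` E) \<longleftrightarrow> inj_on snd E" .
  have "pathstart ` seg ` E = square_center ` fst ` E" "pathfinish ` seg ` E = square_center ` snd ` E"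
    by (simp_all add: image_image)
  then have "pathstart ` seg ` E = pathfinish ` seg ` E \<longleftrightarrow> fst ` E = snd ` E"
    by (simp add: inj_image_eq_iff[OF c])
  then show ?thesis
    by (simp add: balanced_def s f finite_image_iff[OF i])
qed

lemma balanced_remove_pair:
  assumes E: "balanced (seg ` E)" and ab: "(a, b) \<in> E" "(b, a) \<in> E"
  shows "balanced (seg ` (E - {(a, b), (b, a)}))"
proof -
  have E': "finite E" "inj_on fst E" "inj_on snd E" "fst ` E = snd ` E"
    using E by (simp_all add: balanced_seg_iff)
  have "fst ` (E - {(a, b), (b, a)}) = fst ` E - {a, b}"
    using inj_on_image_set_diff[OF E'(2), of E "{(a, b), (b, a)}"] ab by auto
  moreover have "snd ` (E - {(a, b), (b, a)}) = snd ` E - {a, b}"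
    using inj_on_image_set_diff[OF E'(3), of E "{(a, b), (b, a)}"] ab by auto
  ultimately show ?thesis
    unfolding balanced_seg_iff using E' by (auto intro: inj_on_subset)
qed

lemma wind_remove: "finite E \<Longrightarrow> e \<in> E \<Longrightarrow> wind E z = winding_number (seg e) z + wind (E - {e}) z"
  unfolding wind_def by (rule sum.remove)

text \<open>The arc \<open>e\<close> may cross \<open>S\<close>. Rerouting it along a path \<beta>
  with the same endpoints that misses \<open>S\<close> keeps the family balanced, and then its total
  winding is constant on \<open>S\<close>.\<close>

lemma replace_arc:
  assumes E: "balanced (seg ` E)" and e: "e \<in> E"
    and \<beta>: "path \<beta>" "pathstart \<beta> = square_center (fst e)" "pathfinish \<beta> = square_center (snd e)"
    and S: "connected S" "\<And>e'. e' \<in> E - {e} \<Longrightarrow> S \<inter> path_image (seg e') = {}" "S \<inter> path_image \<beta> = {}"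
    and zw: "z \<in> S" "w \<in> S"
  shows "wind (E - {e}) z + winding_number \<beta> z = wind (E - {e}) w + winding_number \<beta> w"
proof -
  have E': "finite E" "inj_on fst E" "inj_on snd E" "fst ` E = snd ` E"
    using E by (simp_all add: balanced_seg_iff)
  let ?A = "insert \<beta> (seg ` (E - {e}))"
  have fst: "fst e \<notin> fst ` (E - {e})" and snd: "snd e \<notin> snd ` (E - {e})"
    using E'(2,3) e by (auto simp: inj_on_def)
  have st: "pathstart ` seg ` (E - {e}) = square_center ` fst ` (E - {e})"
    "pathfinish ` seg ` (E - {e}) = square_center ` snd ` (E - {e})"
    by (simp_all add: image_image)
  have not: "pathstart \<beta> \<notin> pathstart ` seg ` (E - {e})" "pathfinish \<beta> \<notin> pathfinish ` seg ` (E - {e})"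
    unfolding st \<beta> using fst snd by (metis (no_types, lifting) imageE square_center_eq_iff)+
  \<comment> \<open>Otherwise inserting \<beta> into the set of curves would add no summand.\<close>
  have new: "\<beta> \<notin> seg ` (E - {e})" using not(1) by blast
  have "inj_on pathstart (seg ` E)" "inj_on pathfinish (seg ` E)"
    using E unfolding balanced_def by auto
  then have inj: "inj_on pathstart (seg ` (E - {e}))" "inj_on pathfinish (seg ` (E - {e}))"
    by (auto intro: inj_on_subset)
  have "pathstart ` ?A = square_center ` fst ` insert e (E - {e})"
    by (simp add: \<beta> image_image del: insert_Diff_single)
  also have "\<dots> = square_center ` snd ` insert e (E - {e})"
    using E'(4) e by (simp add: insert_absorb)
  also have "\<dots> = pathfinish ` ?A" by (simp add: \<beta> image_image del: insert_Diff_single)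
  finally have "balanced ?A"
    unfolding balanced_def using E'(1) \<beta>(1) inj not by (auto simp: inj_on_insert)
  then have "total_winding ?A z = total_winding ?A w"
    using S(1) _ zw
  proof (rule total_winding_eq)
    show "S \<inter> \<Union>(path_image ` ?A) = {}" using S(2,3) by blast
  qed
  moreover have "total_winding ?A u = winding_number \<beta> u + wind (E - {e}) u" for u
    using new E'(1) by (simp add: total_winding_def flip: total_winding_seg)
  ultimately show ?thesis by (simp add: add.commute)
qed

text \<open>The detour \<open>b, c, d, a\<close> misses \<open>S\<close> and closes the segment from
  \<open>a\<close> to \<open>b\<close> to a loop that winds once around \<open>z\<close> and not
  around \<open>w\<close>. Rerouting along the detour leaves this loop as the only source of a jump;
  two opposite segments cancel.\<close>

lemma wind_jump:
  assumes E: "balanced (seg ` E)" and ne: "a \<noteq> b"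
    and S: "connected S" "\<And>e. e \<in> E - {(a, b), (b, a)} \<Longrightarrow> S \<inter> path_image (seg e) = {}"
    "S \<inter> path_image (seg (b, c)) = {}" "S \<inter> path_image (seg (c, d)) = {}" "S \<inter> path_image (seg (d, a)) = {}"
    and zw: "z \<in> S" "w \<in> S" "z \<notin> path_image (seg (a, b))" "w \<notin> path_image (seg (a, b))"
    and loop: "loop_winding a b c d z = 1" "loop_winding a b c d w = 0"
  shows "wind E z - wind E w = of_bool ((a, b) \<in> E) - of_bool ((b, a) \<in> E)"
proof -
  have fin: "finite E" using E by (simp add: balanced_seg_iff)
  have S': "S \<inter> path_image (seg e) = {}" if "e \<in> E" "e \<noteq> (a, b)" "e \<noteq> (b, a)" for e
    using S(2) that by blast
  define \<beta> where "\<beta> = seg (b, c) +++ seg (c, d) +++ seg (d, a)"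
  have \<beta>: "path \<beta>" "pathstart \<beta> = square_center b" "pathfinish \<beta> = square_center a" "S \<inter> path_image \<beta> = {}"
    using S by (auto simp: \<beta>_def path_image_join)
  have wb: "winding_number \<beta> u = loop_winding a b c d u - winding_number (seg (a, b)) u" if "u \<in> S" for u
  proof -
    have "u \<notin> path_image (seg (b, c))" "u \<notin> path_image (seg (c, d))" "u \<notin> path_image (seg (d, a))"
      using that S by auto
    then show ?thesis by (simp add: \<beta>_def winding_number_join path_image_join loop_winding_def)
  qed
  have rev: "winding_number (seg (b, a)) u = - winding_number (seg (a, b)) u" if "u \<in> {z, w}" for u
    using that zw by (auto simp: winding_seg_reverse)
  consider "(a, b) \<in> E" "(b, a) \<in> E" | "(a, b) \<in> E" "(b, a) \<notin> E" | "(a, b) \<notin> E" "(b, a) \<in> E"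
    | "(a, b) \<notin> E" "(b, a) \<notin> E" by blast
  then show ?thesis
  proof cases
    case 1
    let ?E = "E - {(a, b), (b, a)}"
    have "wind ?E z = wind ?E w"
      unfolding total_winding_seg[symmetric]
      by (rule total_winding_eq[OF balanced_remove_pair[OF E 1] S(1)]) (use S' zw in blast)+
    moreover have "wind E u = wind ?E u" if "u \<in> {z, w}" for u
    proof -
      have "E - {(a, b)} - {(b, a)} = ?E" by blast
      moreover have "wind (E - {(a, b)}) u = winding_number (seg (b, a)) u + wind (E - {(a, b)} - {(b, a)}) u"
        using 1 fin ne by (intro wind_remove) auto
      ultimately show ?thesis using wind_remove[OF fin 1(1), of u] rev[OF that] by simp
    qed
    ultimately show ?thesis using 1 by simp
  next
    case 2
    \<comment> \<open>The detour \<beta> runs from \<open>b\<close> to \<open>a\<close>, so the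
      segment from \<open>a\<close> to \<open>b\<close> is rerouted along its reverse.\<close>
    have "wind (E - {(a, b)}) z + winding_number (reversepath \<beta>) z =
        wind (E - {(a, b)}) w + winding_number (reversepath \<beta>) w"
    proof (rule replace_arc[OF E 2(1) _ _ _ S(1)])
      show "S \<inter> path_image (seg e) = {}" if "e \<in> E - {(a, b)}" for e
        using S' 2 that by blast
    qed (use zw \<beta> in auto)
    moreover have "winding_number (reversepath \<beta>) u = - winding_number \<beta> u" if "u \<in> S" for u
      using \<beta> that by (auto intro: winding_number_reversepath)
    ultimately show ?thesis
      using 2 wind_remove[OF fin 2(1), of z] wind_remove[OF fin 2(1), of w] wb zw loop
      by (simp add: algebra_simps)
  next
    case 3
    have "wind (E - {(b, a)}) z + winding_number \<beta> z = wind (E - {(b, a)}) w + winding_number \<beta> w"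
    proof (rule replace_arc[OF E 3(2) _ _ _ S(1)])
      show "S \<inter> path_image (seg e) = {}" if "e \<in> E - {(b, a)}" for e
        using S' 3 that by blast
    qed (use zw \<beta> in auto)
    then have "wind (E - {(b, a)}) z + (1 - winding_number (seg (a, b)) z) =
        wind (E - {(b, a)}) w - winding_number (seg (a, b)) w"
      using wb[OF zw(1)] wb[OF zw(2)] loop by simp
    moreover have "wind E z = - winding_number (seg (a, b)) z + wind (E - {(b, a)}) z"
      "wind E w = - winding_number (seg (a, b)) w + wind (E - {(b, a)}) w"
      using wind_remove[OF fin 3(2), of z] wind_remove[OF fin 3(2), of w] rev by simp_all
    ultimately have "wind E z - wind E w = - 1" by algebra
    then show ?thesis using 3 by simp
  next
    case 4
    have "wind E z = wind E w"
      unfolding total_winding_seg[symmetric]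
      by (rule total_winding_eq[OF E S(1)]) (use S' zw 4 in blast)+
    then show ?thesis using 4 by simp
  qed
qed

text \<open>\<open>S\<close> is the common side of the squares \<open>(x, y)\<close> and
  \<open>(x + 1, y)\<close>. Its upper end lies to the left of a step from the first to the second,
  and no other grid segment crosses it.\<close>

lemma wind_jump_horizontal:
  assumes E: "balanced (seg ` E)" and adj: "\<And>a b. (a, b) \<in> E \<Longrightarrow> adjacent a b"
  shows "wind E (corner (x, y)) - wind E (corner (x, y - 1)) =
    of_bool (((x, y), (x + 1, y)) \<in> E) - of_bool (((x + 1, y), (x, y)) \<in> E)"
proof (rule wind_jump[OF E, where c = "(x + 1, y + 1)" and d = "(x, y + 1)"
      and S = "closed_segment (corner (x, y - 1)) (corner (x, y))"])
  let ?S = "closed_segment (corner (x, y - 1)) (corner (x, y))"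
  have S: "u \<in> ?S \<longleftrightarrow> Re u = of_int x + 1 \<and> of_int y \<le> Im u \<and> Im u \<le> of_int y + 1" for u
    by (auto simp: corner_def closed_segment_same_Re closed_segment_eq_real_ivl)
  have avoid: "?S \<inter> path_image (seg (a, b)) = {}" if "adjacent a b" "{a, b} \<noteq> {(x, y), (x + 1, y)}" for a b
    using that(1)
  proof (cases rule: adjacent_cases)
    case (1 i j)
    have False if "u \<in> ?S" "u \<in> path_image (seg ((i, j), (i + 1, j)))" for u
    proof -
      have "of_int x + 1 = Re u" "Im u = of_int j + 1/2" "of_int y \<le> Im u" "Im u \<le> of_int y + 1"
        "of_int i + 1/2 \<le> Re u" "Re u \<le> of_int i + 3/2"
        using that by (auto simp: S seg_image_horizontal)
      then have "i = x" "j = y" by linarith+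
      then show False using 1 \<open>{a, b} \<noteq> _\<close> by simp
    qed
    then show ?thesis using 1 by blast
  next
    case (2 i j)
    then show ?thesis by (auto simp: S seg_image_vertical real_int_half)
  qed
  show "?S \<inter> path_image (seg e) = {}" if "e \<in> E - {((x, y), (x + 1, y)), ((x + 1, y), (x, y))}" for e
    using that adj by (cases e) (auto intro!: avoid simp: doubleton_eq_iff)
  show "?S \<inter> path_image (seg ((x + 1, y), (x + 1, y + 1))) = {}"
    "?S \<inter> path_image (seg ((x + 1, y + 1), (x, y + 1))) = {}"
    "?S \<inter> path_image (seg ((x, y + 1), (x, y))) = {}"
    by (rule avoid; simp add: adjacent_iff doubleton_eq_iff)+
  have "around 1 (x, y) (x, y) (x + 1, y) (x + 1, y + 1) (x, y + 1)"
    by (simp add: around_def ccw_def)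
  then show "loop_winding (x, y) (x + 1, y) (x + 1, y + 1) (x, y + 1) (corner (x, y)) = 1"
    "loop_winding (x, y) (x + 1, y) (x + 1, y + 1) (x, y + 1) (corner (x, y - 1)) = 0"
    by (simp_all add: loop_winding_corner)
qed (auto simp: corner_notin_seg adjacent_iff)

text \<open>Here \<open>S\<close> is the common side of \<open>(x, y)\<close> and
  \<open>(x, y + 1)\<close>, and its left end \<open>corner (x - 1, y)\<close> lies to the left of
  an upward step.\<close>

lemma wind_jump_vertical:
  assumes E: "balanced (seg ` E)" and adj: "\<And>a b. (a, b) \<in> E \<Longrightarrow> adjacent a b"
  shows "wind E (corner (x - 1, y)) - wind E (corner (x, y)) =
    of_bool (((x, y), (x, y + 1)) \<in> E) - of_bool (((x, y + 1), (x, y)) \<in> E)"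
proof (rule wind_jump[OF E, where c = "(x - 1, y + 1)" and d = "(x - 1, y)"
      and S = "closed_segment (corner (x - 1, y)) (corner (x, y))"])
  let ?S = "closed_segment (corner (x - 1, y)) (corner (x, y))"
  have S: "u \<in> ?S \<longleftrightarrow> Im u = of_int y + 1 \<and> of_int x \<le> Re u \<and> Re u \<le> of_int x + 1" for u
    by (auto simp: corner_def closed_segment_same_Im closed_segment_eq_real_ivl)
  have avoid: "?S \<inter> path_image (seg (a, b)) = {}" if "adjacent a b" "{a, b} \<noteq> {(x, y), (x, y + 1)}" for a b
    using that(1)
  proof (cases rule: adjacent_cases)
    case (2 i j)
    have False if "u \<in> ?S" "u \<in> path_image (seg ((i, j), (i, j + 1)))" for u
    proof -
      have "of_int y + 1 = Im u" "Re u = of_int i + 1/2" "of_int x \<le> Re u" "Re u \<le> of_int x + 1"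
        "of_int j + 1/2 \<le> Im u" "Im u \<le> of_int j + 3/2"
        using that by (auto simp: S seg_image_vertical)
      then have "i = x" "j = y" by linarith+
      then show False using 2 \<open>{a, b} \<noteq> _\<close> by simp
    qed
    then show ?thesis using 2 by blast
  next
    case (1 i j)
    then show ?thesis by (auto simp: S seg_image_horizontal real_int_half)
  qed
  show "?S \<inter> path_image (seg e) = {}" if "e \<in> E - {((x, y), (x, y + 1)), ((x, y + 1), (x, y))}" for e
    using that adj by (cases e) (auto intro!: avoid simp: doubleton_eq_iff)
  show "?S \<inter> path_image (seg ((x, y + 1), (x - 1, y + 1))) = {}"
    "?S \<inter> path_image (seg ((x - 1, y + 1), (x - 1, y))) = {}"
    "?S \<inter> path_image (seg ((x - 1, y), (x, y))) = {}"
    by (rule avoid; simp add: adjacent_iff doubleton_eq_iff)+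
  have "around 1 (x - 1, y) (x, y) (x, y + 1) (x - 1, y + 1) (x - 1, y)"
    by (simp add: around_def ccw_def)
  then show "loop_winding (x, y) (x, y + 1) (x - 1, y + 1) (x - 1, y) (corner (x - 1, y)) = 1"
    "loop_winding (x, y) (x, y + 1) (x - 1, y + 1) (x - 1, y) (corner (x, y)) = 0"
    by (simp_all add: loop_winding_corner)
qed (auto simp: corner_notin_seg adjacent_iff)

section \<open>Loops in a simply connected floor\<close>

text \<open>Lift the loop to the floor, contract it there and project the homotopy to the plane. The
  projection never meets the center of \<open>s\<close>, because no cube of this floor lies over
  \<open>s\<close>.\<close>

lemma floor_loop_null:
  assumes sc: "simply_connected (\<Union>(cube_body ` story R i))" and s: "s \<notin> shadow R i"
    and \<gamma>: "path \<gamma>" "pathfinish \<gamma> = pathstart \<gamma>" "path_image \<gamma> \<subseteq> \<Union>(square_body ` shadow R i)"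
  shows "winding_number \<gamma> (square_center s) = 0"
proof -
  let ?S = "\<Union>(cube_body ` story R i)" and ?z = "square_center s"
  \<comment> \<open>Height \<open>of_int i\<close> places the lifted loop on the bottom faces of the
    cubes.\<close>
  define up :: "complex \<Rightarrow> real^3" where "up = (\<lambda>w. vector [Re w, Im w, of_int i])"
  define down :: "real^3 \<Rightarrow> complex" where "down = (\<lambda>v. Complex (v $ 1) (v $ 2))"
  have up: "continuous_on UNIV up"
  proof -
    have "continuous_on UNIV (\<lambda>w. up w $ k)" for k
      using exhaust_3[of k] by (elim disjE; simp add: up_def; intro continuous_intros)
    then have "continuous_on UNIV (\<lambda>w. \<chi> k. up w $ k)" by (rule continuous_on_vec_lambda)
    then show ?thesis by simp
  qed
  have down: "continuous_on UNIV down"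
    unfolding down_def Complex_eq by (intro continuous_intros)
  have cube: "v \<in> cube_body (x, y, z) \<longleftrightarrow> of_int x \<le> v $ 1 \<and> v $ 1 \<le> of_int x + 1 \<and>
      of_int y \<le> v $ 2 \<and> v $ 2 \<le> of_int y + 1 \<and> of_int z \<le> v $ 3 \<and> v $ 3 \<le> of_int z + 1" for v x y z
    by (auto simp: mem_box_cart forall_3)
  have up_in: "up w \<in> ?S" if w: "w \<in> \<Union>(square_body ` shadow R i)" for w
  proof -
    obtain x y where xy: "(x, y, i) \<in> R" "w \<in> square_body (x, y)" using w by (auto simp: shadow_def simp del: square_body.simps)
    then have "up w \<in> cube_body (x, y, i)" unfolding cube by (auto simp: up_def in_cbox_complex_iff)
    then show ?thesis using xy by (auto simp: story_def simp del: cube_body.simps)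
  qed
  have down_in: "down v \<noteq> ?z" if v: "v \<in> ?S" for v
  proof
    assume eq: "down v = ?z"
    obtain x y where xy: "(x, y, i) \<in> R" "v \<in> cube_body (x, y, i)"
      using v by (auto simp: story_def simp del: cube_body.simps)
    obtain u w where uw: "s = (u, w)" by (cases s)
    have "v $ 1 = of_int u + 1/2" "v $ 2 = of_int w + 1/2"
      using eq by (auto simp: uw down_def square_center.simps)
    then have "u = x" "w = y" using xy(2) unfolding cube by linarith+
    then show False using s xy uw by (simp add: shadow_def)
  qed
  define c where "c = up (pathstart \<gamma>)"
  have "homotopic_loops ?S (up \<circ> \<gamma>) (linepath c c)"
  proof (rule sc[unfolded simply_connected_def, rule_format], intro conjI)
    show "path (up \<circ> \<gamma>)" using \<gamma>(1) up by (intro path_continuous_image) (auto intro: continuous_on_subset)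
    show "pathfinish (up \<circ> \<gamma>) = pathstart (up \<circ> \<gamma>)"
      using \<gamma>(2) by (simp add: pathfinish_compose pathstart_compose)
    show "path_image (up \<circ> \<gamma>) \<subseteq> ?S" using \<gamma>(3) up_in by (auto simp: path_image_compose)
    show "path_image (linepath c c) \<subseteq> ?S"
      using \<gamma>(3) up_in pathstart_in_path_image[of \<gamma>] by (auto simp: c_def)
  qed auto
  then have "homotopic_loops (- {?z}) (down \<circ> (up \<circ> \<gamma>)) (down \<circ> linepath c c)"
    by (rule homotopic_loops_continuous_image) (use down down_in in \<open>auto intro: continuous_on_subset\<close>)
  moreover have "down \<circ> (up \<circ> \<gamma>) = \<gamma>" by (auto simp: down_def up_def)
  moreover have "down \<circ> linepath c c = linepath (down c) (down c)"
    by (auto simp: linepath_def simp flip: scaleR_add_left)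
  moreover have "down c \<noteq> ?z"
    using \<gamma>(3) up_in pathstart_in_path_image[of \<gamma>] down_in by (auto simp: c_def)
  ultimately show ?thesis
    using winding_number_homotopic_loops[of ?z \<gamma> "linepath (down c) (down c)"] winding_number_zero_const
    by (auto simp: winding_number_trivial)
qed

section \<open>Local moves\<close>

lemma two_story_floor_tiling:
  assumes R: "two_story_region R" and t: "is_tiling R t"
  shows "floor_tiling R t"
proof
  show "snd (snd c) \<in> {0, 1}" if "c \<in> R" for c
  proof -
    have "c \<in> story R 0 \<union> story R 1" using R that by (simp add: two_story_region_def)
    then show ?thesis by (auto simp: story_def)
  qed
qed (use R t in \<open>simp_all add: two_story_region_def\<close>)

lemma is_tiling_replace:
  assumes t: "is_tiling R t" and T: "T \<subseteq> t" and T': "is_tiling (\<Union>T) T'"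
  shows "is_tiling R ((t - T) \<union> T')"
proof -
  have d: "disjoint t" "disjoint T'" using t T' by (simp_all add: is_tiling_def)
  have U: "\<Union>T' = \<Union>T" "\<Union>t = R" using t T' by (simp_all add: is_tiling_def)
  have off: "A \<inter> B = {}" if "A \<in> t - T" "B \<in> T" for A B
  proof (rule disjointD[OF d(1)])
    show "A \<in> t" "B \<in> t" "A \<noteq> B" using that T by auto
  qed
  have off': "A \<inter> B = {}" if "A \<in> t - T" "B \<in> T'" for A B
    using off[OF that(1)] U(1) that(2) by blast
  have "disjoint ((t - T) \<union> T')"
  proof (rule disjointI)
    fix A B assume AB: "A \<in> (t - T) \<union> T'" "B \<in> (t - T) \<union> T'" "A \<noteq> B"
    then consider "A \<in> t" "B \<in> t" | "A \<in> t - T" "B \<in> T'" | "B \<in> t - T" "A \<in> T'" | "A \<in> T'" "B \<in> T'"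
      by blast
    then show "A \<inter> B = {}"
      using disjointD[OF d(1)] disjointD[OF d(2)] off' AB(3) by cases (simp, blast+)
  qed
  moreover have "\<Union>((t - T) \<union> T') = R" using U T by blast
  ultimately show ?thesis using t T' by (auto simp: is_tiling_def)
qed

lemma steps_replace: "steps ((t - T) \<union> T') = (steps t - steps T) \<union> steps T'"
  by (auto simp: steps_def)

lemma jewels_replace: "jewels ((t - T) \<union> T') = (jewels t - jewels T) \<union> jewels T'"
  by (auto simp: jewels_def)

text \<open>Two visible elements on the left, so that rewriting an explicit set stops at singletons,
  where the \<open>steps_single\<close> lemmas take over.\<close>

lemma steps_insert2: "steps (insert d (insert e t)) = steps {d} \<union> steps (insert e t)"
  by (auto simp: steps_def)

lemma jewels_insert2: "jewels (insert d (insert e t)) = jewels {d} \<union> jewels (insert e t)"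
  by (auto simp: jewels_def)

lemma steps_single_horizontal:
  assumes "adjacent a b"
  shows "steps {{over a (parity a), over b (parity a)}} = {(a, b)}"
proof -
  have "s = a \<and> s' = b"
    if "adjacent s s'" "{over s (parity s), over s' (parity s)} = {over a (parity a), over b (parity a)}" for s s'
    using that adjacent_parity[OF assms] parity_range[of a] by (auto simp: doubleton_eq_iff)
  then show ?thesis using assms unfolding steps_def by blast
qed

lemma steps_single_vertical: "steps {{over s 0, over s 1}} = {}"
  by (auto simp: steps_def doubleton_eq_iff)

lemma jewels_single_horizontal: "a \<noteq> b \<Longrightarrow> jewels {{over a f, over b f}} = {}"
  by (auto simp: jewels_over doubleton_eq_iff)

lemma jewels_single_vertical: "jewels {{over s 0, over s 1}} = {s}"
  by (auto simp: jewels_over doubleton_eq_iff)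

lemma wind_exchange:
  assumes "finite E" "e1 \<in> E" "e2 \<in> E" "e1 \<noteq> e2" "g1 \<notin> E" "g2 \<notin> E" "g1 \<noteq> g2"
  shows "wind ((E - {e1, e2}) \<union> {g1, g2}) z = wind E z - winding_number (seg e1) z - winding_number (seg e2) z
    + winding_number (seg g1) z + winding_number (seg g2) z"
proof -
  have "wind E z = winding_number (seg e1) z + (winding_number (seg e2) z + wind (E - {e1} - {e2}) z)"
    using assms by (simp add: wind_remove[of E e1] wind_remove[of "E - {e1}" e2])
  moreover have "E - {e1} - {e2} = E - {e1, e2}" by blast
  moreover have "(E - {e1, e2}) \<union> {g1, g2} = insert g1 (insert g2 (E - {e1, e2}))" by blast
  ultimately show ?thesis using assms by (simp add: wind_def)
qed

text \<open>A trit triple seen from above: a path \<open>a, b, c\<close> and a jewel at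
  \<open>d\<close>. Of the block it leaves out the black cube over \<open>a\<close> and the white
  cube over \<open>c\<close>. The other tiling of the same cubes is
  \<open>trip a d c b\<close>.\<close>

definition trip :: "square \<Rightarrow> square \<Rightarrow> square \<Rightarrow> square \<Rightarrow> dimer set" where
  "trip a b c d = {{over a (parity a), over b (parity a)},
     {over b (parity b), over c (parity b)}, {over d 0, over d 1}}"

lemma around_parity:
  assumes "around \<epsilon> p a b c d"
  shows "parity b = 1 - parity a" "parity c = parity a" "parity d = 1 - parity a"
  using around_adjacent[OF assms, THEN adjacent_parity] by auto

lemma around_swap: "around \<epsilon> p a b c d \<Longrightarrow> around (- \<epsilon>) p a d c b"
  using around_reverse around_rotate by blast

lemma steps_trip: "around \<epsilon> p a b c d \<Longrightarrow> steps (trip a b c d) = {(a, b), (b, c)}"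
  unfolding trip_def
  by (auto simp: steps_insert2 steps_single_horizontal around_adjacent steps_single_vertical)

lemma jewels_trip:
  assumes "around \<epsilon> p a b c d"
  shows "jewels (trip a b c d) = {d}"
  using around_distinct[OF assms] unfolding trip_def
  by (simp add: jewels_insert2 jewels_single_horizontal jewels_single_vertical)

lemma Union_trip:
  assumes "around \<epsilon> p a b c d"
  shows "\<Union>(trip a b c d) = {over a (parity a), over b 0, over b 1, over c (1 - parity a), over d 0, over d 1}"
  using around_parity[OF assms] parity_range[of a] by (auto simp: trip_def)

lemma is_tiling_trip:
  assumes "around \<epsilon> p a b c d"
  shows "is_tiling (\<Union>(trip a b c d)) (trip a b c d)"
proof -
  have "is_dimer {over d 0, over d 1}" using z_dimer_over by (auto simp: is_dimer_def)
  moreover have "disjoint (trip a b c d)"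
    using around_distinct[OF assms] around_parity[OF assms] parity_range[of a]
    by (auto simp: trip_def disjoint_def)
  ultimately show ?thesis
    using around_adjacent[OF assms] by (auto simp: is_tiling_def trip_def is_dimer_over)
qed

lemma trit_triple_trip:
  assumes "around \<epsilon> p a b c d"
  shows "trit_triple (fst p, snd p, 0) (trip a b c d)"
proof -
  obtain x y where p: "p = (x, y)" by (cases p)
  let ?f = "parity a" and ?g = "parity b"
  have fg: "?f \<in> {0, 1}" "?g \<in> {0, 1}" using parity_range[of a] parity_range[of b] by simp_all
  have cube: "over s f \<in> big_cube (x, y, 0)" if "s \<in> {a, b, c, d}" "f \<in> {0, 1}" for s f
  proof -
    have "s \<in> {x, x + 1} \<times> {y, y + 1}" using that(1) unfolding around_set[OF assms] p fst_conv snd_conv .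
    then show ?thesis using that(2)
      unfolding mem_Times_iff over_def big_cube.simps fst_conv snd_conv by simp
  qed
  have xd: "x_dimer {over (u, v) f, over (u + 1, v) f}" for u v f
    unfolding x_dimer_def over_def fst_conv snd_conv by blast
  have yd: "y_dimer {over (u, v) f, over (u, v + 1) f}" for u v f
    unfolding y_dimer_def over_def fst_conv snd_conv by blast
  \<comment> \<open>Which of the two horizontal dimers is the x-dimer depends on the square of the
    block at which the path starts.\<close>
  have "x_dimer {over a ?f, over b ?f} \<and> y_dimer {over b ?g, over c ?g} \<or>
      y_dimer {over a ?f, over b ?f} \<and> x_dimer {over b ?g, over c ?g}"
    using assms xd[of x y] xd[of x "y + 1"] yd[of x y] yd[of "x + 1" y]
    unfolding around_def ccw_def p by (auto simp: insert_commute)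
  moreover have "{over a ?f, over b ?f} \<subseteq> big_cube (x, y, 0)" "{over b ?g, over c ?g} \<subseteq> big_cube (x, y, 0)"
    "{over d 0, over d 1} \<subseteq> big_cube (x, y, 0)"
    using cube fg by auto
  moreover have "z_dimer {over d 0, over d 1}" by (rule z_dimer_over)
  moreover have "trip a b c d = {{over b ?g, over c ?g}, {over a ?f, over b ?f}, {over d 0, over d 1}}"
    by (auto simp: trip_def)
  ultimately show ?thesis unfolding trit_triple_def p fst_conv snd_conv
    using trip_def by metis
qed

section \<open>Trits and flips, their inverses and their effect on the winding\<close>

context floor_tiling
begin

lemma floor_tiling_replace:
  assumes "T \<subseteq> t" "is_tiling (\<Union>T) T'"
  shows "floor_tiling R ((t - T) \<union> T')"
  using is_tiling_replace[OF tiling assms] finite_R floors by unfold_locales auto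

text \<open>A dimer of \<open>T'\<close> already in \<open>t\<close> would share a cube with a dimer
  of \<open>T\<close>, hence be equal to it. So removing \<open>T'\<close> again takes away only
  what was inserted.\<close>

lemma replace_undo:
  assumes "T \<subseteq> t" "is_tiling (\<Union>T) T'" "T \<inter> T' = {}"
  shows "(((t - T) \<union> T') - T') \<union> T = t"
proof -
  have "d \<notin> t" if "d \<in> T'" for d
  proof
    assume d: "d \<in> t"
    have "d \<subseteq> \<Union>T" using that assms(2) by (auto simp: is_tiling_def)
    moreover have "d \<noteq> {}" using assms(2) that
      by (auto simp: is_tiling_def is_dimer_def x_dimer_def y_dimer_def z_dimer_def)
    ultimately obtain c e where "c \<in> d" "c \<in> e" "e \<in> T" by blast
    then have "d = e" using dimer_unique[OF d] assms(1) by blast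
    then show False using \<open>e \<in> T\<close> that assms(3) by blast
  qed
  then show ?thesis using assms(1) by blast
qed

text \<open>The new segments minus the old ones are \<open>(a, d)\<close>, \<open>(d, c)\<close>
  against \<open>(a, b)\<close>, \<open>(b, c)\<close>. Reversing the new ones turns the difference
  into minus the loop \<open>a, b, c, d\<close>, which is why \<open>z\<close> has to avoid
  them.\<close>

lemma trip_exchange:
  assumes ar: "around \<epsilon> p a b c d" and T: "trip a b c d \<subseteq> t"
    and t': "t' = (t - trip a b c d) \<union> trip a d c b"
  shows "floor_tiling R t'"
    and "steps t' = (steps t - {(a, b), (b, c)}) \<union> {(a, d), (d, c)}"
    and "jewels t' = (jewels t - {d}) \<union> {b}"
    and "z \<notin> path_image (seg (a, d)) \<Longrightarrow> z \<notin> path_image (seg (d, c)) \<Longrightarrow>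
      wind (steps t') z = wind (steps t) z - loop_winding a b c d z"
    and "(t' - trip a d c b) \<union> trip a b c d = t"
    and "trip a d c b \<noteq> trip a b c d"
    and "trip a d c b \<subseteq> t'"
    and "is_tiling (\<Union>(trip a b c d)) (trip a d c b)"
proof -
  have ar': "around (- \<epsilon>) p a d c b" using ar by (rule around_swap)
  have dist: "distinct [a, b, c, d]" using ar by (rule around_distinct)
  have U: "\<Union>(trip a d c b) = \<Union>(trip a b c d)"
    unfolding Union_trip[OF ar] Union_trip[OF ar'] by auto
  show til: "is_tiling (\<Union>(trip a b c d)) (trip a d c b)"
    using is_tiling_trip[OF ar'] U by simp
  have disj: "trip a b c d \<inter> trip a d c b = {}"
    using dist around_parity[OF ar] by (auto simp: trip_def doubleton_eq_iff)
  moreover have "trip a b c d \<noteq> {}" by (simp add: trip_def)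
  ultimately show "trip a d c b \<noteq> trip a b c d" by (metis Int_absorb)
  show "floor_tiling R t'" unfolding t' by (rule floor_tiling_replace[OF T til])
  show s: "steps t' = (steps t - {(a, b), (b, c)}) \<union> {(a, d), (d, c)}"
    unfolding t' steps_replace steps_trip[OF ar] steps_trip[OF ar'] ..
  show "jewels t' = (jewels t - {d}) \<union> {b}"
    unfolding t' jewels_replace jewels_trip[OF ar] jewels_trip[OF ar'] ..
  show "(t' - trip a d c b) \<union> trip a b c d = t"
    unfolding t' by (rule replace_undo[OF T til disj])
  show "trip a d c b \<subseteq> t'" unfolding t' by blast
  have mem: "(a, b) \<in> steps t" "(b, c) \<in> steps t" "d \<in> jewels t"
    using T around_adjacent[OF ar] by (auto simp: trip_def steps_iff jewels_over)
  show "wind (steps t') z = wind (steps t) z - loop_winding a b c d z"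
    if "z \<notin> path_image (seg (a, d))" "z \<notin> path_image (seg (d, c))"
    unfolding s using mem dist finite_steps jewel_no_step[OF mem(3)]
    by (subst wind_exchange)
      (auto simp: loop_winding_def winding_seg_reverse[OF that(1)] winding_seg_reverse[OF that(2)])
qed

lemma trit_move:
  assumes ar: "around \<epsilon> p a b c d" and st: "(a, b) \<in> steps t" "(b, c) \<in> steps t" "d \<in> jewels t"
    and sub: "{fst p, fst p + 1} \<times> {snd p, snd p + 1} \<times> {0, 1} \<subseteq> R"
  shows "\<exists>t'. trit R t t' \<and> trit R t' t \<and> floor_tiling R t' \<and>
    (\<forall>q. wind (steps t') (corner q) = wind (steps t) (corner q) - (if q = p then of_int \<epsilon> else 0))"
proof -
  let ?v = "(fst p, snd p, 0)"
  have T: "trip a b c d \<subseteq> t" using st by (auto simp: trip_def steps_iff jewels_over)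
  define t' where "t' = (t - trip a b c d) \<union> trip a d c b"
  have ar': "around (- \<epsilon>) p a d c b" using ar by (rule around_swap)
  note ex = trip_exchange[OF ar T t'_def]
  have v: "big_cube ?v \<subseteq> R" using sub by auto
  have "trit_at R ?v (trip a b c d) (trip a d c b) t t'"
    unfolding trit_at_def using v T trit_triple_trip[OF ar] ex t'_def by blast
  moreover have "trit_at R ?v (trip a d c b) (trip a b c d) t' t"
  proof -
    interpret t': floor_tiling R t' by (rule ex(1))
    show ?thesis
      unfolding trit_at_def
      using v ex(7) trit_triple_trip[OF ar'] ex(5,6) t'.trip_exchange(8)[OF ar' ex(7) refl] by auto
  qed
  moreover have "wind (steps t') (corner q) = wind (steps t) (corner q) - (if q = p then of_int \<epsilon> else 0)" for q
    using ex(4)[of "corner q"] around_adjacent[OF ar] adjacent_commute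
    by (simp add: corner_notin_seg loop_winding_corner[OF ar])
  ultimately show ?thesis using ex(1) unfolding trit_def by blast
qed

lemma flip_replace:
  assumes T: "{d1, d2} \<subseteq> t" and B: "flat_box (d1 \<union> d2)" "d1 \<union> d2 = e1 \<union> e2"
    and e: "is_dimer e1" "is_dimer e2" "disjoint {e1, e2}" "{d1, d2} \<inter> {e1, e2} = {}"
    and t': "t' = (t - {d1, d2}) \<union> {e1, e2}"
  shows "floor_tiling R t'" "flip t t'" "flip t' t"
proof -
  have til: "is_tiling (\<Union>{d1, d2}) {e1, e2}" using e B by (auto simp: is_tiling_def)
  show "floor_tiling R t'" unfolding t' by (rule floor_tiling_replace[OF T til])
  have d: "is_dimer d1" "is_dimer d2" using T tiling by (auto simp: is_tiling_def)
  have ne: "{e1, e2} \<noteq> {d1, d2}" using e(4) by (metis Int_absorb insert_not_empty)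
  have "d1 \<in> t" "d2 \<in> t" using T by auto
  then show "flip t t'" unfolding flip_def
    using B(1) B(2)[symmetric] e(1,2) ne t' by blast
  have "t = (t' - {e1, e2}) \<union> {d1, d2}" unfolding t' using replace_undo[OF T til e(4)] by simp
  moreover have "e1 \<in> t'" "e2 \<in> t'" "flat_box (e1 \<union> e2)" using t' B by auto
  ultimately show "flip t' t" unfolding flip_def
    using B(2) d ne[symmetric] by blast
qed

text \<open>\<open>a\<close> and \<open>c\<close> have equal parity, so the two segments lie on one
  floor and are parallel dimers of a flat box. The flip reconnects \<open>a\<close> to
  \<open>d\<close> and \<open>c\<close> to \<open>b\<close>, and the change is the same unit loop as
  for a trit.\<close>

lemma flip_move:
  assumes ar: "around \<epsilon> p a b c d" and st: "(a, b) \<in> steps t" "(c, d) \<in> steps t"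
  shows "\<exists>t'. flip t t' \<and> flip t' t \<and> floor_tiling R t' \<and>
    (\<forall>q. wind (steps t') (corner q) = wind (steps t) (corner q) - (if q = p then of_int \<epsilon> else 0))"
proof -
  let ?f = "parity a"
  have dist: "distinct [a, b, c, d]" using ar by (rule around_distinct)
  have pc: "parity c = ?f" using around_parity[OF ar] by simp
  have adj: "adjacent a d" "adjacent c b" using around_adjacent[OF ar] adjacent_commute by auto
  let ?T = "{{over a ?f, over b ?f}, {over c ?f, over d ?f}}"
    and ?T' = "{{over a ?f, over d ?f}, {over c ?f, over b ?f}}"
  define t' where "t' = (t - ?T) \<union> ?T'"
  have T: "?T \<subseteq> t" using st pc by (auto simp: steps_iff)
  have set: "{a, b, c, d} = {fst p, fst p + 1} \<times> {snd p, snd p + 1}" by (rule around_set[OF ar])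
  have "{over a ?f, over b ?f} \<union> {over c ?f, over d ?f} = (\<lambda>s. over s ?f) ` {a, b, c, d}" by auto
  also have "\<dots> = {fst p, fst p + 1} \<times> {snd p, snd p + 1} \<times> {?f}"
    unfolding set by (auto simp: over_def)
  finally have "flat_box ({over a ?f, over b ?f} \<union> {over c ?f, over d ?f})"
    unfolding flat_box_def by blast
  note fl = flip_replace[OF T this _ _ _ _ _ t'_def]
  have fl: "floor_tiling R t'" "flip t t'" "flip t' t"
    by (rule fl; use dist adj is_dimer_over in \<open>auto simp: disjoint_def doubleton_eq_iff\<close>)+
  have steps2: "steps ?T = {(a, b), (c, d)}" "steps ?T' = {(a, d), (c, b)}"
    using steps_single_horizontal[of a b] steps_single_horizontal[of c d]
      steps_single_horizontal[of a d] steps_single_horizontal[of c b] adj around_adjacent[OF ar] pc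
    by (auto simp: steps_insert2)
  have s: "steps t' = (steps t - {(a, b), (c, d)}) \<union> {(a, d), (c, b)}"
    unfolding t'_def steps_replace steps2 ..
  have "(a, d) \<notin> steps t" "(c, b) \<notin> steps t"
    using steps_out_unique[OF st(1), of d] steps_out_unique[OF st(2), of b] dist by auto
  then have "wind (steps t') (corner q) = wind (steps t) (corner q) - loop_winding a b c d (corner q)" for q
    unfolding s using st dist finite_steps adj
    by (subst wind_exchange)
      (auto simp: loop_winding_def winding_seg_reverse[of _ a d] winding_seg_reverse[of _ c b] corner_notin_seg)
  then have "wind (steps t') (corner q) = wind (steps t) (corner q) - (if q = p then of_int \<epsilon> else 0)" for q
    by (simp add: loop_winding_corner[OF ar])
  then show ?thesis using fl by blast
qed

text \<open>Opposite segments lie on different floors, one dimer above the other. The flip in their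
  upright box turns them into two jewels, and their windings cancelled already.\<close>

lemma pair_move:
  assumes st: "(a, b) \<in> steps t" "(b, a) \<in> steps t"
  shows "\<exists>t'. flip t t' \<and> flip t' t \<and> floor_tiling R t' \<and> steps t' \<subset> steps t \<and>
    (\<forall>q. wind (steps t') (corner q) = wind (steps t) (corner q))"
proof -
  have adj: "adjacent a b" "adjacent b a" using st by (auto simp: steps_iff)
  have ne: "a \<noteq> b" using adj by auto
  have pb: "parity b = 1 - parity a" using adj adjacent_parity by blast
  let ?T = "{{over a (parity a), over b (parity a)}, {over b (parity b), over a (parity b)}}"
    and ?T' = "{{over a 0, over a 1}, {over b 0, over b 1}}"
  define t' where "t' = (t - ?T) \<union> ?T'"
  have T: "?T \<subseteq> t" using st by (auto simp: steps_iff)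
  have U: "{over a (parity a), over b (parity a)} \<union> {over b (parity b), over a (parity b)} =
      {over a 0, over a 1} \<union> {over b 0, over b 1}"
    using parity_range[of a] pb by auto
  obtain x y where "{a, b} = {(x, y), (x + 1, y)} \<or> {a, b} = {(x, y), (x, y + 1)}"
    using adjacent_cases[OF adj(1)] by metis
  \<comment> \<open>The spelling \<open>{0, 0 + 1}\<close> matches \<open>{z, z + 1}\<close> in
    \<open>flat_box\<close>.\<close>
  then have "(\<lambda>s. over s 0) ` {a, b} \<union> (\<lambda>s. over s 1) ` {a, b} = {x, x + 1} \<times> {y} \<times> {0, 0 + 1} \<or>
      (\<lambda>s. over s 0) ` {a, b} \<union> (\<lambda>s. over s 1) ` {a, b} = {x} \<times> {y, y + 1} \<times> {0, 0 + 1}"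
    by (elim disjE; simp only:) (auto simp: over_def)
  moreover have "(\<lambda>s. over s 0) ` {a, b} \<union> (\<lambda>s. over s 1) ` {a, b} = {over a 0, over a 1} \<union> {over b 0, over b 1}"
    by auto
  ultimately have fb: "flat_box ({over a (parity a), over b (parity a)} \<union> {over b (parity b), over a (parity b)})"
    unfolding U flat_box_def by metis
  note fl = flip_replace[OF T fb U _ _ _ _ t'_def]
  have z: "is_dimer {over s 0, over s 1}" for s using z_dimer_over by (auto simp: is_dimer_def)
  have fl: "floor_tiling R t'" "flip t t'" "flip t' t"
    by (rule fl; use z ne in \<open>auto simp: disjoint_def doubleton_eq_iff\<close>)+
  have steps2: "steps ?T = {(a, b), (b, a)}" "steps ?T' = {}"
    using steps_single_horizontal[of a b] steps_single_horizontal[of b a] adj steps_single_vertical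
    by (auto simp: steps_insert2)
  have s: "steps t' = steps t - {(a, b), (b, a)}"
    unfolding t'_def steps_replace steps2 by simp
  have "wind (steps t') (corner q) = wind (steps t) (corner q)" for q
  proof -
    have "wind (steps t) (corner q) = winding_number (seg (a, b)) (corner q) +
        (winding_number (seg (b, a)) (corner q) + wind (steps t - {(a, b)} - {(b, a)}) (corner q))"
      using st ne finite_steps wind_remove[of "steps t" "(a, b)"] wind_remove[of "steps t - {(a, b)}" "(b, a)"] by simp
    moreover have "steps t - {(a, b)} - {(b, a)} = steps t'" unfolding s by blast
    ultimately show ?thesis using winding_seg_reverse[of "corner q" a b] corner_notin_seg[OF adj(1)] by simp
  qed
  moreover have "steps t' \<subset> steps t" using s st by blast
  ultimately show ?thesis using fl by blast
qed

end

section \<open>Connectivity of the tilings of a duplex region\<close>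

text \<open>A highest face that is lowest and then leftmost has its bottom and left sides on the flow.
  Looking at the fourth vertex of the face, either the flow can be pushed across this face or
  across its right neighbour, or there is a cycle of length two.\<close>

lemma ex_reducible_face:
  fixes h :: "square \<Rightarrow> int" and E :: "(square \<times> square) set"
  assumes hh: "\<And>x y. h (x, y) - h (x, y - 1) =
      of_bool (((x, y), (x + 1, y)) \<in> E) - of_bool (((x + 1, y), (x, y)) \<in> E)"
    and hv: "\<And>x y. h (x - 1, y) - h (x, y) =
      of_bool (((x, y), (x, y + 1)) \<in> E) - of_bool (((x, y + 1), (x, y)) \<in> E)"
    and adj: "\<And>a b. (a, b) \<in> E \<Longrightarrow> adjacent a b"
    and out_unique: "\<And>s a b. (s, a) \<in> E \<Longrightarrow> (s, b) \<in> E \<Longrightarrow> a = b"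
    and in_unique: "\<And>s a b. (a, s) \<in> E \<Longrightarrow> (b, s) \<in> E \<Longrightarrow> a = b"
    and vertex: "\<And>s. s \<in> D \<Longrightarrow> s \<in> J \<or> (\<exists>a b. (s, a) \<in> E \<and> (b, s) \<in> E)"
    and through: "\<And>a s. (a, s) \<in> E \<Longrightarrow> \<exists>b. (s, b) \<in> E"
    and supp: "\<And>x y. h (x, y) \<noteq> 0 \<Longrightarrow> (x + 1, y + 1) \<in> D"
    and fin: "finite {p. h p \<noteq> 0}" and pos: "h p0 > 0"
  shows "(\<exists>p a b c d. ccw p a b c d \<and> h p > 0 \<and> (a, b) \<in> E \<and> ((b, c) \<in> E \<and> d \<in> J \<or> (c, d) \<in> E))
    \<or> (\<exists>a b. (a, b) \<in> E \<and> (b, a) \<in> E)"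
proof -
  define M where "M = Max (h ` {p. h p \<noteq> 0})"
  have fin': "finite (h ` {p. h p \<noteq> 0})" using fin by simp
  have p0: "h p0 \<in> h ` {p. h p \<noteq> 0}" using pos by auto
  have M: "M > 0" using Max_ge[OF fin' p0] pos unfolding M_def by linarith
  have le: "h p \<le> M" for p
  proof (cases "h p = 0")
    case False
    then show ?thesis unfolding M_def using fin' by (intro Max_ge) auto
  qed (use M in simp)
  have "M \<in> h ` {p. h p \<noteq> 0}" unfolding M_def using fin' p0 by (intro Max_in) auto
  then obtain p1 where p1: "h p1 = M" by auto
  define F where "F = {p. h p = M}"
  have F: "finite F" by (rule finite_subset[OF _ fin]) (use M in \<open>auto simp: F_def\<close>)
  define y where "y = Min (snd ` F)"
  have "y \<in> snd ` F" unfolding y_def using F p1 by (intro Min_in) (unfold F_def, blast+)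
  moreover have y_le: "y \<le> snd p" if "p \<in> F" for p
    unfolding y_def using F that by (intro Min_le) auto
  define G where "G = {x. (x, y) \<in> F}"
  have G: "finite G" by (rule finite_subset[of _ "fst ` F"]) (use F in \<open>force simp: G_def\<close>)+
  define x where "x = Min G"
  ultimately have "G \<noteq> {}" by (auto simp: G_def)
  then have "x \<in> G" unfolding x_def using G by (intro Min_in) auto
  then have h: "h (x, y) = M" by (simp add: G_def F_def)
  have below: "h (u, y - 1) < M" for u
    using y_le[of "(u, y - 1)"] le[of "(u, y - 1)"] by (fastforce simp: F_def)
  have left: "h (x - 1, y) < M"
  proof -
    have "x - 1 \<notin> G" using Min_le[OF G, of "x - 1"] unfolding x_def[symmetric] by auto
    then show ?thesis using le[of "(x - 1, y)"] by (auto simp: G_def F_def)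
  qed
  \<comment> \<open>Jumps are at most one, so a strict drop across a side determines the step on it:
    the flow comes down the left side and leaves to the right along the bottom,
    counterclockwise.\<close>
  have bottom: "((x, y), (x + 1, y)) \<in> E" "((x + 1, y), (x, y)) \<notin> E" "h (x, y - 1) = M - 1"
    using hh[of x y] below[of x] h by (auto simp: of_bool_def split: if_splits)
  have side: "((x, y + 1), (x, y)) \<in> E"
    using hv[of x y] left h by (auto simp: of_bool_def split: if_splits)
  let ?e = "(x + 1, y + 1)"
  have "?e \<in> D" using supp h M by simp
  then consider "?e \<in> J" | a b where "(?e, a) \<in> E" "(b, ?e) \<in> E" using vertex by blast
  then show ?thesis
  proof cases
    case 1
    have "ccw (x, y) (x, y + 1) (x, y) (x + 1, y) ?e" by (simp add: ccw_def)
    then show ?thesis using 1 side bottom h M by blast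
  next
    case (2 a b)
    consider "a = b" | "a = (x, y + 1)" | "b = (x + 1, y)"
      | "a \<noteq> b" "a \<noteq> (x, y + 1)" "b \<noteq> (x + 1, y)" by blast
    then show ?thesis
    proof cases
      case 1
      then show ?thesis using 2 by blast
    next
      assume a: "a = (x, y + 1)"
      have "ccw (x, y) (x, y) (x + 1, y) ?e (x, y + 1)" by (simp add: ccw_def)
      then show ?thesis using a 2 bottom h M by blast
    next
      assume b: "b = (x + 1, y)"
      have "ccw (x, y) (x, y + 1) (x, y) (x + 1, y) ?e" by (simp add: ccw_def)
      then show ?thesis using b 2 side h M by blast
    next
      assume ne: "a \<noteq> b" "a \<noteq> (x, y + 1)" "b \<noteq> (x + 1, y)"
      \<comment> \<open>\<open>(x + 1, y)\<close> already has the predecessor \<open>(x, y)\<close>,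
        and \<open>(x, y + 1)\<close> already has the successor \<open>(x, y)\<close>. So the flow
        through \<open>?e\<close> can use only the right and the upper neighbour.\<close>
      have a: "a = (x + 2, y + 1) \<or> a = (x + 1, y + 2)"
        using adj[OF 2(1)] ne(2) in_unique[OF bottom(1), of ?e] 2(1) unfolding adjacent_iff by auto
      have b: "b = (x + 2, y + 1) \<or> b = (x + 1, y + 2)"
        using adj[OF 2(2)] ne(3) out_unique[OF side, of ?e] 2(2)
        unfolding adjacent_commute[of b] adjacent_iff by auto
      have notop: "((x, y + 1), ?e) \<notin> E" "(?e, (x, y + 1)) \<notin> E" "((x + 1, y), ?e) \<notin> E" "(?e, (x + 1, y)) \<notin> E"
        using in_unique[OF 2(2), of "(x, y + 1)"] in_unique[OF 2(2), of "(x + 1, y)"]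
          out_unique[OF 2(1), of "(x, y + 1)"] out_unique[OF 2(1), of "(x + 1, y)"] a b by auto
      have up: "h (x, y + 1) = M" using hh[of x "y + 1"] notop h by simp
      have right: "h (x + 1, y) = M" using hv[of "x + 1" y] notop h by simp
      from a b ne(1) consider "a = (x + 2, y + 1)" "b = (x + 1, y + 2)"
        | "a = (x + 1, y + 2)" "b = (x + 2, y + 1)" by blast
      then show ?thesis
      proof cases
        case 1
        then have "((x + 1, y + 2), ?e) \<in> E" "(?e, (x + 1, y + 2)) \<notin> E"
          using 2 out_unique[OF 2(1), of "(x + 1, y + 2)"] by auto
        \<comment> \<open>Flow entering \<open>?e\<close> from above would lift the face beyond it
          over the maximum.\<close>
        then have "h (x + 1, y + 1) = M + 1"
          using hv[of "x + 1" "y + 1"] up by (simp add: add.assoc)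
        then show ?thesis using le[of "(x + 1, y + 1)"] by simp
      next
        case eq: 2
        obtain c where c: "((x + 1, y), c) \<in> E" using through[OF bottom(1)] by blast
        \<comment> \<open>A downward turn would create a highest face in the row below the lowest
          one.\<close>
        have "c \<noteq> (x + 1, y - 1)"
        proof
          assume c': "c = (x + 1, y - 1)"
          then have "((x + 1, y - 1), (x + 1, y)) \<notin> E" using in_unique[OF bottom(1), of "(x + 1, y - 1)"] by auto
          then have "h (x + 1, y - 1) = M"
            using hv[of "x + 1" "y - 1"] bottom(3) c c' by simp
          then show False using below[of "x + 1"] by simp
        qed
        moreover have "c \<noteq> (x, y)" "c \<noteq> ?e" using c bottom notop by auto
        \<comment> \<open>The flow thus runs to the right along the bottom of the right neighbour
          face and to the left along its top, which is a flip there.\<close>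
        ultimately have "c = (x + 2, y)" using adj[OF c] unfolding adjacent_iff by auto
        moreover have "ccw (x + 1, y) (x + 1, y) (x + 2, y) (x + 2, y + 1) ?e" by (simp add: ccw_def)
        ultimately show ?thesis using c 2 eq right M by blast
      qed
    qed
  qed
qed

section \<open>The height function of a duplex tiling and its descent\<close>

definition height :: "dimer set \<Rightarrow> square \<Rightarrow> int" where
  "height t p = \<lfloor>Re (wind (steps t) (corner p))\<rfloor>"

definition volume :: "cube set \<Rightarrow> dimer set \<Rightarrow> nat" where
  "volume R t = (\<Sum>p\<in>shadow R 0. nat \<bar>height t p\<bar>)"

locale duplex_tiling = floor_tiling +
  assumes simply: "simply_connected (\<Union>(cube_body ` story R 0))"
    and duplex: "shadow R 0 = shadow R 1"
begin

lemma over_in_R: "f \<in> {0, 1} \<Longrightarrow> over s f \<in> R \<longleftrightarrow> s \<in> shadow R 0"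
  using duplex by (cases s) (auto simp: shadow_def over_def)

lemma parity_over_in_R: "over s (parity s) \<in> R \<longleftrightarrow> s \<in> shadow R 0" "over s (1 - parity s) \<in> R \<longleftrightarrow> s \<in> shadow R 0"
  using over_in_R[of "parity s" s] over_in_R[of "1 - parity s" s] parity_range[of s] by auto

lemma finite_shadow: "finite (shadow R 0)"
proof (rule finite_subset)
  show "shadow R 0 \<subseteq> proj ` R" by (force simp: shadow_def image_iff)
qed (simp add: finite_R)

lemma balanced_steps: "balanced (seg ` steps t)"
proof -
  have "holes R = {}" using duplex by (simp add: holes_def)
  then have "ghost_curves R {}"
    by (simp add: ghost_curves_def initial_holes_def terminal_holes_def bij_betw_def)
  then show ?thesis using balanced_arcs arcs_eq[of "{}"] by fastforce
qed

lemma step_adjacent: "(a, b) \<in> steps t \<Longrightarrow> adjacent a b"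
  by (simp add: steps_iff)

text \<open>Integrality comes from the closed curves, so taking the real part and the floor in
  \<open>height\<close> only changes the type.\<close>

lemma of_int_height: "of_int (height t p) = wind (steps t) (corner p)"
proof -
  have "corner p \<notin> \<Union>(path_image ` seg ` steps t)"
    using corner_notin_seg step_adjacent by fast
  then have "wind (steps t) (corner p) \<in> \<int>"
    using total_winding_integer[OF balanced_steps] by (simp add: total_winding_seg)
  then show ?thesis by (auto simp: height_def elim!: Ints_cases)
qed

lemma height_jump:
  "height t (x, y) - height t (x, y - 1) =
     of_bool (((x, y), (x + 1, y)) \<in> steps t) - of_bool (((x + 1, y), (x, y)) \<in> steps t)"
  "height t (x - 1, y) - height t (x, y) =
     of_bool (((x, y), (x, y + 1)) \<in> steps t) - of_bool (((x, y + 1), (x, y)) \<in> steps t)"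
proof -
  have *: "i - j = of_bool P - of_bool Q"
    if "(of_int i :: complex) - of_int j = of_bool P - of_bool Q" for i j P Q
  proof -
    have "(of_int (i - j) :: complex) = of_int (of_bool P - of_bool Q)" using that by simp
    then show ?thesis unfolding of_int_eq_iff .
  qed
  show "height t (x, y) - height t (x, y - 1) =
     of_bool (((x, y), (x + 1, y)) \<in> steps t) - of_bool (((x + 1, y), (x, y)) \<in> steps t)"
    by (rule *, unfold of_int_height, rule wind_jump_horizontal[OF balanced_steps step_adjacent])
  show "height t (x - 1, y) - height t (x, y) =
     of_bool (((x, y), (x, y + 1)) \<in> steps t) - of_bool (((x, y + 1), (x, y)) \<in> steps t)"
    by (rule *, unfold of_int_height, rule wind_jump_vertical[OF balanced_steps step_adjacent])
qed

lemma seg_subset_shadow: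
  assumes "(a, b) \<in> steps t"
  shows "path_image (seg (a, b)) \<subseteq> \<Union>(square_body ` shadow R 0)"
proof -
  have ab: "a \<in> shadow R 0" "b \<in> shadow R 0"
    using step_in_R[OF assms] parity_over_in_R by auto
  have "path_image (seg (a, b)) \<subseteq> square_body a \<union> square_body b"
    using step_adjacent[OF assms]
  proof (cases rule: adjacent_cases)
    case (1 x y)
    have "square_body a \<union> square_body b = square_body (x, y) \<union> square_body (x + 1, y)"
      using arg_cong[OF 1(1), of "\<lambda>A. \<Union>(square_body ` A)"] by (simp del: square_body.simps)
    moreover have "z \<in> square_body (x, y) \<union> square_body (x + 1, y)"
      if "z \<in> path_image (seg ((x, y), (x + 1, y)))" for z
      using that unfolding seg_image_horizontal Un_iff square_body.simps in_cbox_complex_iff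
      by simp linarith
    ultimately show ?thesis unfolding 1(2) by blast
  next
    case (2 x y)
    have "square_body a \<union> square_body b = square_body (x, y) \<union> square_body (x, y + 1)"
      using arg_cong[OF 2(1), of "\<lambda>A. \<Union>(square_body ` A)"] by (simp del: square_body.simps)
    moreover have "z \<in> square_body (x, y) \<union> square_body (x, y + 1)"
      if "z \<in> path_image (seg ((x, y), (x, y + 1)))" for z
      using that unfolding seg_image_vertical Un_iff square_body.simps in_cbox_complex_iff
      by simp linarith
    ultimately show ?thesis unfolding 2(2) by blast
  qed
  then show ?thesis using ab by blast
qed

lemma height_outside:
  assumes "s \<in> {fst p, fst p + 1} \<times> {snd p, snd p + 1}" "s \<notin> shadow R 0"
  shows "height t p = 0"
proof -
  let ?X = "\<Union>(square_body ` shadow R 0)"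
  have ns: "s \<noteq> a" "s \<noteq> b" if "(a, b) \<in> steps t" for a b
    using step_in_R[OF that] parity_over_in_R assms(2) by auto
  \<comment> \<open>No segment passes through the missing square \<open>s\<close>, so the half
    diagonal carries the winding from \<open>corner p\<close> to its center.\<close>
  have "closed_segment (square_center s) (corner p) \<inter> \<Union>(path_image ` seg ` steps t) = {}"
  proof -
    have "closed_segment (square_center s) (corner p) \<inter> path_image (seg (a, b)) = {}" if "(a, b) \<in> steps t" for a b
      using diagonal_avoids_seg[OF step_adjacent[OF that] ns[OF that] assms(1)] .
    then show ?thesis by fast
  qed
  then have "wind (steps t) (corner p) = wind (steps t) (square_center s)"
    using total_winding_eq[OF balanced_steps connected_segment(1)] by (simp add: total_winding_seg)
  also have "\<dots> = 0"
    unfolding total_winding_seg[symmetric]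
  proof (rule total_winding_zero[OF balanced_steps])
    show "\<Union>(path_image ` seg ` steps t) \<subseteq> ?X" using seg_subset_shadow by fast
    show "square_center s \<notin> ?X"
    proof
      assume "square_center s \<in> ?X"
      then obtain x y where xy: "(x, y) \<in> shadow R 0" "square_center s \<in> square_body (x, y)" by force
      obtain u v where s: "s = (u, v)" by (cases s)
      have "of_int x \<le> (of_int u + 1/2 :: real)" "(of_int u + 1/2 :: real) \<le> of_int x + 1"
        "of_int y \<le> (of_int v + 1/2 :: real)" "(of_int v + 1/2 :: real) \<le> of_int y + 1"
        using xy(2) by (auto simp: s in_cbox_complex_iff square_center.simps)
      then have "u = x" "v = y" by linarith+
      then show False using xy(1) assms(2) s by simp
    qed
    show "winding_number \<gamma> (square_center s) = 0"
      if "path \<gamma>" "pathfinish \<gamma> = pathstart \<gamma>" "path_image \<gamma> \<subseteq> ?X" for \<gamma>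
      using floor_loop_null[OF simply assms(2) that] .
  qed
  finally show ?thesis using of_int_height[of p] by (metis of_int_eq_0_iff)
qed

lemma height_support: "height t p \<noteq> 0 \<Longrightarrow> {fst p, fst p + 1} \<times> {snd p, snd p + 1} \<subseteq> shadow R 0"
  using height_outside by blast

lemma height_support': "height t p \<noteq> 0 \<Longrightarrow> p \<in> shadow R 0"
  using height_outside[of p p] by (auto simp: mem_Times_iff)

lemma finite_height_support: "finite {p. height t p \<noteq> 0}"
proof (rule finite_subset[OF _ finite_shadow])
  show "{p. height t p \<noteq> 0} \<subseteq> shadow R 0"
    using height_support' by blast
qed

lemma duplex_tilingI: "floor_tiling R t' \<Longrightarrow> duplex_tiling R t'"
  using simply duplex by (simp add: duplex_tiling_def duplex_tiling_axioms_def)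

text \<open>For negative heights all segments are reversed: this negates the height function and
  turns a counterclockwise face into a clockwise one, which \<epsilon> records.\<close>

lemma ex_reducible_around:
  assumes "height t p0 \<noteq> 0"
  shows "(\<exists>\<epsilon> p a b c d. around \<epsilon> p a b c d \<and> \<epsilon> * height t p > 0 \<and> (a, b) \<in> steps t \<and>
      ((b, c) \<in> steps t \<and> d \<in> jewels t \<or> (c, d) \<in> steps t))
    \<or> (\<exists>a b. (a, b) \<in> steps t \<and> (b, a) \<in> steps t)"
proof -
  have ex_out: "\<exists>b. (s, b) \<in> steps t" and ex_in: "\<exists>b. (b, s) \<in> steps t"
    if "s \<in> shadow R 0" "s \<notin> jewels t" for s
    using ex_step_out ex_step_in that parity_over_in_R by auto
  have vertex: "s \<in> jewels t \<or> (\<exists>a b. (s, a) \<in> steps t \<and> (b, s) \<in> steps t)" if "s \<in> shadow R 0" for s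
    using ex_out ex_in that by blast
  have through_out: "\<exists>b. (s, b) \<in> steps t" if "(a, s) \<in> steps t" for a s
    using ex_out step_in_R(2)[OF that] jewel_no_step(2) that parity_over_in_R by blast
  have through_in: "\<exists>b. (b, s) \<in> steps t" if "(s, a) \<in> steps t" for a s
    using ex_in step_in_R(1)[OF that] jewel_no_step(1) that parity_over_in_R by blast
  have supp: "(x + 1, y + 1) \<in> shadow R 0" if "height t (x, y) \<noteq> 0" for x y
    using height_support[OF that] by auto
  show ?thesis
  proof (cases "height t p0 > 0")
    case True
    have "(\<exists>p a b c d. ccw p a b c d \<and> height t p > 0 \<and> (a, b) \<in> steps t \<and>
        ((b, c) \<in> steps t \<and> d \<in> jewels t \<or> (c, d) \<in> steps t))
      \<or> (\<exists>a b. (a, b) \<in> steps t \<and> (b, a) \<in> steps t)"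
      by (rule ex_reducible_face[where D = "shadow R 0" and h = "height t", OF height_jump step_adjacent
            steps_out_unique steps_in_unique vertex through_out supp finite_height_support True])
    moreover have "around 1 p a b c d \<and> 1 * height t p > 0" if "ccw p a b c d" "height t p > 0" for p a b c d
      using that by (simp add: around_def)
    ultimately show ?thesis by blast
  next
    case False
    let ?E = "(steps t)\<inverse>"
    have "(\<exists>p a b c d. ccw p a b c d \<and> - height t p > 0 \<and> (a, b) \<in> ?E \<and>
        ((b, c) \<in> ?E \<and> d \<in> jewels t \<or> (c, d) \<in> ?E))
      \<or> (\<exists>a b. (a, b) \<in> ?E \<and> (b, a) \<in> ?E)"
    proof (rule ex_reducible_face[where D = "shadow R 0" and h = "\<lambda>p. - height t p"])
      show "- height t (x, y) - - height t (x, y - 1) =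
          of_bool (((x, y), (x + 1, y)) \<in> ?E) - of_bool (((x + 1, y), (x, y)) \<in> ?E)" for x y
        using height_jump(1)[of x y] by simp
      show "- height t (x - 1, y) - - height t (x, y) =
          of_bool (((x, y), (x, y + 1)) \<in> ?E) - of_bool (((x, y + 1), (x, y)) \<in> ?E)" for x y
        using height_jump(2)[of x y] by simp
      show "adjacent a b" if "(a, b) \<in> ?E" for a b
        using that step_adjacent adjacent_commute by blast
      show "s \<in> jewels t \<or> (\<exists>a b. (s, a) \<in> ?E \<and> (b, s) \<in> ?E)" if "s \<in> shadow R 0" for s
        using vertex[OF that] by blast
      show "finite {p. - height t p \<noteq> 0}" using finite_height_support by simp
      show "- height t p0 > 0" using False assms by simp
      show "(x + 1, y + 1) \<in> shadow R 0" if "- height t (x, y) \<noteq> 0" for x y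
        using supp that by simp
    qed (use steps_out_unique steps_in_unique through_in in blast)+
    moreover have "\<exists>\<epsilon> p a b c d. around \<epsilon> p a b c d \<and> \<epsilon> * height t p > 0 \<and> (a, b) \<in> steps t \<and>
        ((b, c) \<in> steps t \<and> d \<in> jewels t \<or> (c, d) \<in> steps t)"
      if cc: "ccw p a b c d" and h: "- height t p > 0" and ab: "(a, b) \<in> ?E"
        and or: "(b, c) \<in> ?E \<and> d \<in> jewels t \<or> (c, d) \<in> ?E" for p a b c d
    proof -
      have "ccw p c d a b" using ccw_rotate ccw_rotate cc by blast
      moreover then have "ccw p d a b c" using ccw_rotate by blast
      \<comment> \<open>Two clockwise labellings of the same face: \<open>b, a, d, c\<close> starts
        the reversed pair of a flip, \<open>c, b, a, d\<close> the reversed path of a trit.\<close>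
      ultimately have "around (- 1) p b a d c" "around (- 1) p c b a d" by (auto simp: around_def)
      moreover have "- 1 * height t p > 0" using h by simp
      moreover have "(b, a) \<in> steps t" "(c, b) \<in> steps t \<and> d \<in> jewels t \<or> (d, c) \<in> steps t"
        using ab or by auto
      ultimately show ?thesis by blast
    qed
    ultimately show ?thesis by blast
  qed
qed

text \<open>A flat height function has no jump across any edge, so a step and its reverse are
  present together.\<close>

lemma ex_pair_if_flat:
  assumes "\<And>p. height t p = 0" "(a, b) \<in> steps t"
  shows "(b, a) \<in> steps t"
proof -
  obtain x y where a: "a = (x, y)" by (cases a)
  have "b = (x + 1, y) \<or> b = (x - 1, y) \<or> b = (x, y + 1) \<or> b = (x, y - 1)"
    using step_adjacent[OF assms(2)] unfolding a adjacent_iff .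
  then show ?thesis
    using assms height_jump(1)[of x y] height_jump(1)[of "x - 1" y]
      height_jump(2)[of x y] height_jump(2)[of x "y - 1"]
    by (auto simp: a of_bool_def split: if_splits)
qed

lemma height_eqI:
  assumes "duplex_tiling R t'" "wind (steps t') (corner q) = wind (steps t) (corner q) - of_int k"
  shows "height t' q = height t q - k"
  using duplex_tiling.of_int_height[OF assms(1), of q] of_int_height[of q] assms(2)
  by (metis of_int_diff of_int_eq_iff)

text \<open>\<epsilon> is the sign of the height at \<open>p\<close>, so subtracting it brings this
  one height closer to zero.\<close>

lemma volume_less:
  assumes "around \<epsilon> p a b c d" "\<epsilon> * height t p > 0" "duplex_tiling R t'"
    "\<forall>q. wind (steps t') (corner q) = wind (steps t) (corner q) - (if q = p then of_int \<epsilon> else 0)"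
  shows "volume R t' < volume R t"
proof -
  have e: "\<epsilon> = 1 \<or> \<epsilon> = - 1" using assms(1) by (auto simp: around_def)
  have h: "height t' q = height t q - (if q = p then \<epsilon> else 0)" for q
    by (rule height_eqI[OF assms(3)]) (simp add: assms(4))
  have "height t p \<noteq> 0" using assms(2) by auto
  then have p: "p \<in> shadow R 0" by (rule height_support')
  show ?thesis unfolding volume_def
  proof (rule sum_strict_mono_ex1[OF finite_shadow])
    show "\<forall>q\<in>shadow R 0. nat \<bar>height t' q\<bar> \<le> nat \<bar>height t q\<bar>"
      unfolding h using e assms(2) by auto
    show "\<exists>q\<in>shadow R 0. nat \<bar>height t' q\<bar> < nat \<bar>height t q\<bar>"
      by (rule bexI[OF _ p]) (use e assms(2) in \<open>auto simp: h\<close>)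
  qed
qed

lemma ex_decreasing_move:
  assumes "steps t \<noteq> {}"
  shows "\<exists>t'. (flip t t' \<or> trit R t t') \<and> (flip t' t \<or> trit R t' t) \<and> duplex_tiling R t' \<and>
    (volume R t' < volume R t \<or> volume R t' = volume R t \<and> steps t' \<subset> steps t)"
proof -
  consider (pair) a b where "(a, b) \<in> steps t" "(b, a) \<in> steps t"
    | (face) \<epsilon> p a b c d where "around \<epsilon> p a b c d" "\<epsilon> * height t p > 0" "(a, b) \<in> steps t"
        "(b, c) \<in> steps t \<and> d \<in> jewels t \<or> (c, d) \<in> steps t"
  proof (cases "\<forall>p. height t p = 0")
    case True
    obtain a b where "(a, b) \<in> steps t" using assms by auto
    then show ?thesis using pair ex_pair_if_flat True by blast
  next
    case False
    then show ?thesis using pair face ex_reducible_around by blast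
  qed
  then show ?thesis
  proof cases
    case pair
    obtain t' where t': "flip t t'" "flip t' t" "floor_tiling R t'" "steps t' \<subset> steps t"
      "\<forall>q. wind (steps t') (corner q) = wind (steps t) (corner q)"
      using pair_move[OF pair] by blast
    have "height t' q = height t q" for q by (simp add: height_def t'(5))
    then have "volume R t' = volume R t" by (simp add: volume_def)
    then show ?thesis using t'(1,2,4) duplex_tilingI[OF t'(3)] by (intro exI[of _ t']) simp
  next
    case face
    show ?thesis
    proof (cases "(c, d) \<in> steps t")
      case True
      obtain t' where t': "flip t t'" "flip t' t" "floor_tiling R t'"
        "\<forall>q. wind (steps t') (corner q) = wind (steps t) (corner q) - (if q = p then of_int \<epsilon> else 0)"
        using flip_move[OF face(1,3) True] by blast
      then show ?thesis
        using volume_less[OF face(1,2) _ t'(4)] duplex_tilingI[OF t'(3)] by (intro exI[of _ t']) simp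
    next
      case False
      have "height t p \<noteq> 0" using face(2) by auto
      then have "{fst p, fst p + 1} \<times> {snd p, snd p + 1} \<subseteq> shadow R 0" by (rule height_support)
      \<comment> \<open>A trit requires the whole cube of side two in the region, including the two
        cubes it leaves uncovered; a nonzero height guarantees all four squares.\<close>
      then have sub: "{fst p, fst p + 1} \<times> {snd p, snd p + 1} \<times> {0, 1} \<subseteq> R"
        using duplex by (fastforce simp: shadow_def)
      obtain t' where t': "trit R t t'" "trit R t' t" "floor_tiling R t'"
        "\<forall>q. wind (steps t') (corner q) = wind (steps t) (corner q) - (if q = p then of_int \<epsilon> else 0)"
        using trit_move[OF face(1,3) _ _ sub] face(4) False by blast
      then show ?thesis
        using volume_less[OF face(1,2) _ t'(4)] duplex_tilingI[OF t'(3)] by (intro exI[of _ t']) simp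
    qed
  qed
qed

lemma all_vertical:
  assumes "steps t = {}"
  shows "t = (\<lambda>s. {over s 0, over s 1}) ` shadow R 0"
proof
  show "t \<subseteq> (\<lambda>s. {over s 0, over s 1}) ` shadow R 0"
  proof
    fix d assume d: "d \<in> t"
    then show "d \<in> (\<lambda>s. {over s 0, over s 1}) ` shadow R 0"
    proof (cases rule: tile_cases)
      case (vertical s)
      then have "s \<in> shadow R 0" using dimer_subset[OF d] over_in_R[of 0 s] by auto
      then show ?thesis using vertical by blast
    next
      case (horizontal a b)
      then have "(a, b) \<in> steps t" using d by (simp add: steps_iff)
      then show ?thesis using assms by simp
    qed
  qed
  show "(\<lambda>s. {over s 0, over s 1}) ` shadow R 0 \<subseteq> t"
  proof
    fix d assume "d \<in> (\<lambda>s. {over s 0, over s 1}) ` shadow R 0"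
    then obtain s where s: "s \<in> shadow R 0" "d = {over s 0, over s 1}" by blast
    have "s \<in> jewels t" using ex_step_out[of s] assms parity_over_in_R(1) s(1) by blast
    then show "d \<in> t" using s by (simp add: jewels_over)
  qed
qed

end

text \<open>Lexicographic descent: the number of segments decreases in the moves that cancel a pair
  and leave the volume unchanged. The relation records both directions, so that it is
  symmetric.\<close>

lemma connected_to_vertical:
  assumes "duplex_tiling R t"
  shows "(\<lambda>t t'. (flip t t' \<or> trit R t t') \<and> (flip t' t \<or> trit R t' t))\<^sup>*\<^sup>* t
    ((\<lambda>s. {over s 0, over s 1}) ` shadow R 0)"
  using assms
proof (induction "(volume R t, card (steps t))" arbitrary: t
    rule: wf_induct_rule[OF wf_lex_prod[OF wf_less_than wf_less_than]])
  case (1 t)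
  interpret duplex_tiling R t by (rule 1)
  show ?case
  proof (cases "steps t = {}")
    case True
    then show ?thesis using all_vertical by simp
  next
    case False
    then obtain t' where t': "flip t t' \<or> trit R t t'" "flip t' t \<or> trit R t' t" "duplex_tiling R t'"
      "volume R t' < volume R t \<or> volume R t' = volume R t \<and> steps t' \<subset> steps t"
      using ex_decreasing_move by blast
    have "((volume R t', card (steps t')), (volume R t, card (steps t))) \<in> less_than <*lex*> less_than"
      using t'(4) psubset_card_mono[OF finite_steps] by auto
    note 1(1)[OF this t'(3)]
    then show ?thesis using t'(1,2) by (intro converse_rtranclp_into_rtranclp[of _ t t']) auto
  qed
qed

theorem duplex_connected:
  assumes R: "duplex_region R" and t: "is_tiling R t0" "is_tiling R t1"
  shows "(\<lambda>t t'. flip t t' \<or> trit R t t')\<^sup>*\<^sup>* t0 t1"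
proof -
  let ?m = "\<lambda>t t'. (flip t t' \<or> trit R t t') \<and> (flip t' t \<or> trit R t' t)"
  have two: "two_story_region R" and sh: "shadow R 0 = shadow R 1" using R by (auto simp: duplex_region_def)
  have dt: "duplex_tiling R t" if "is_tiling R t" for t
    using two_story_floor_tiling[OF two that] two sh
    by (simp add: duplex_tiling_def duplex_tiling_axioms_def two_story_region_def)
  have sym: "symp ?m" by (auto intro: sympI)
  have "?m\<^sup>*\<^sup>* t0 t1"
    using connected_to_vertical[OF dt[OF t(1)]] connected_to_vertical[OF dt[OF t(2)]]
      sympD[OF symp_rtranclp[OF sym]] by (meson rtranclp_trans)
  then show ?thesis by (rule rtranclp_mono[THEN predicate2D, rotated]) auto
qed

section \<open>The effect of a positive trit\<close>

lemma is_tiling_subset_eq: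
  assumes "is_tiling R t" "is_tiling R t'" "t \<subseteq> t'"
  shows "t = t'"
proof (rule ccontr)
  assume "t \<noteq> t'"
  then obtain d where d: "d \<in> t'" "d \<notin> t" using assms(3) by blast
  have "d \<noteq> {}" using assms(2) d(1)
    by (auto simp: is_tiling_def is_dimer_def x_dimer_def y_dimer_def z_dimer_def)
  then obtain c where c: "c \<in> d" by blast
  then have "c \<in> \<Union>t" using assms(1,2) d(1) unfolding is_tiling_def by blast
  then obtain e where e: "e \<in> t" "c \<in> e" by blast
  have "e \<inter> d = {}"
    using assms(2,3) e d by (intro disjointD[of t']) (auto simp: is_tiling_def)
  then show False using c e by blast
qed

text \<open>Steps from \<open>b\<close> or \<open>d\<close> can end only at \<open>c\<close>, as the
  black cube over \<open>a\<close> is absent. The step into \<open>b\<close> excludes a jewel there,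
  so \<open>b\<close> takes \<open>c\<close>, and \<open>d\<close> is left with a jewel.\<close>

lemma trip_unique:
  assumes ar: "around \<epsilon> p a b c d" and T: "is_tiling (\<Union>(trip a b c d)) T"
    and ab: "(a, b) \<in> steps T"
  shows "T = trip a b c d"
proof -
  let ?U = "\<Union>(trip a b c d)"
  note U = Union_trip[OF ar]
  note par = around_parity[OF ar]
  have dist: "distinct [a, b, c, d]" using ar by (rule around_distinct)
  interpret floor_tiling ?U T
  proof
    show "finite ?U" unfolding U by simp
    show "snd (snd q) \<in> {0, 1}" if "q \<in> ?U" for q
      using that parity_range[of a] unfolding U by (auto simp: over_def)
  qed (rule T)
  have out: "s' = c" if "(s, s') \<in> steps T" "s \<in> {b, d}" for s s'
  proof -
    have adj: "adjacent s s'" using that(1) by (simp add: steps_iff)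
    have ps: "parity s = 1 - parity a" using that(2) par by auto
    have "parity s' = parity a" using adjacent_parity[OF adj] ps by simp
    then have "over s' (1 - parity a) \<in> ?U" using step_in_R(2)[OF that(1)] by simp
    moreover have "s' \<noteq> b" "s' \<noteq> d" using \<open>parity s' = parity a\<close> par parity_range[of a] by auto
    moreover have "parity a \<noteq> 1 - parity a" by presburger
    ultimately show ?thesis unfolding U by auto
  qed
  have inU: "over b (parity b) \<in> ?U" "over d (parity d) \<in> ?U"
    unfolding U using parity_range[of b] parity_range[of d] by auto
  have "b \<notin> jewels T" using ab jewel_no_step(2) by blast
  then have bc: "(b, c) \<in> steps T" using ex_step_out[OF inU(1)] out by blast
  have dj: "d \<in> jewels T"
  proof (rule ccontr)
    assume "d \<notin> jewels T"
    then have "(d, c) \<in> steps T" using ex_step_out[OF inU(2)] out by blast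
    then have "d = b" using bc steps_in_unique by blast
    then show False using dist by simp
  qed
  have "trip a b c d \<subseteq> T"
    using ab bc dj by (auto simp: trip_def steps_iff jewels_over)
  then show ?thesis using is_tiling_subset_eq[OF is_tiling_trip[OF ar] T] by simp
qed

text \<open>The only cube over \<open>a\<close> is white and must be paired with a cube over
  \<open>b\<close> or \<open>d\<close>; either choice determines the rest.\<close>

lemma other_trip:
  assumes ar: "around \<epsilon> p a b c d" and T: "is_tiling (\<Union>(trip a b c d)) T" and ne: "T \<noteq> trip a b c d"
  shows "T = trip a d c b"
proof -
  let ?U = "\<Union>(trip a b c d)"
  note U = Union_trip[OF ar]
  have ar': "around (- \<epsilon>) p a d c b" using ar by (rule around_swap)
  have U': "?U = \<Union>(trip a d c b)"
    unfolding Union_trip[OF ar] Union_trip[OF ar'] by auto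
  have dist: "distinct [a, b, c, d]" using ar by (rule around_distinct)
  interpret floor_tiling ?U T
  proof
    show "finite ?U" unfolding U by simp
    show "snd (snd q) \<in> {0, 1}" if "q \<in> ?U" for q
      using that parity_range[of a] unfolding U by (auto simp: over_def)
  qed (rule T)
  have "over a (parity a) \<in> ?U" unfolding U by simp
  moreover have "over a (1 - parity a) \<notin> ?U"
  proof -
    have "parity a \<noteq> 1 - parity a" by presburger
    then show ?thesis unfolding U using dist by auto
  qed
  then have "a \<notin> jewels T" using jewel_in_R by blast
  ultimately obtain s where s: "(a, s) \<in> steps T" using ex_step_out by blast
  have adj: "adjacent a s" using s by (simp add: steps_iff)
  have "over s (parity a) \<in> ?U" using step_in_R(2)[OF s] adjacent_parity[OF adj] by simp
  moreover have "s \<noteq> a" using adj by auto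
  moreover have "parity a \<noteq> 1 - parity a" by presburger
  ultimately have "s = b \<or> s = d" unfolding U by auto
  then show ?thesis
    using trip_unique[OF ar T] trip_unique[OF ar' T[unfolded U']] s ne by blast
qed

text \<open>Disjointness puts the x- and y-dimer on different floors and the z-dimer off their row
  and column. Their projections then meet in the square opposite to the jewel, which is the middle
  \<open>b\<close> of the path.\<close>

lemma trit_triple_obtain_trip:
  assumes T: "trit_triple (x, y, 0) T" and disj: "disjoint T"
  obtains \<epsilon> a b c d where "around \<epsilon> (x, y) a b c d" "T = trip a b c d"
proof -
  let ?K = "big_cube (x, y, 0)"
  have K: "(u, v, w) \<in> ?K \<longleftrightarrow> u \<in> {x, x + 1} \<and> v \<in> {y, y + 1} \<and> w \<in> {0, 1}" for u v w
    unfolding big_cube.simps mem_Times_iff by simp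
  obtain dx dy dz where d: "T = {dx, dy, dz}" "x_dimer dx" "y_dimer dy" "z_dimer dz"
    "dx \<subseteq> ?K" "dy \<subseteq> ?K" "dz \<subseteq> ?K"
    using T unfolding trit_triple_def by blast
  obtain x1 y1 z1 where dx: "dx = {(x1, y1, z1), (x1 + 1, y1, z1)}" using d(2) unfolding x_dimer_def by blast
  obtain x2 y2 z2 where dy: "dy = {(x2, y2, z2), (x2, y2 + 1, z2)}" using d(3) unfolding y_dimer_def by blast
  obtain x3 y3 z3 where dz: "dz = {(x3, y3, z3), (x3, y3, z3 + 1)}" using d(4) unfolding z_dimer_def by blast
  have "x1 \<in> {x, x + 1} \<and> x1 + 1 \<in> {x, x + 1} \<and> y1 \<in> {y, y + 1} \<and> z1 \<in> {0, 1}"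
    using d(5) unfolding dx insert_subset K by blast
  then have 1: "x1 = x" "y1 \<in> {y, y + 1}" "z1 \<in> {0, 1}" by auto
  have "x2 \<in> {x, x + 1} \<and> y2 \<in> {y, y + 1} \<and> y2 + 1 \<in> {y, y + 1} \<and> z2 \<in> {0, 1}"
    using d(6) unfolding dy insert_subset K by blast
  then have 2: "x2 \<in> {x, x + 1}" "y2 = y" "z2 \<in> {0, 1}" by auto
  have "x3 \<in> {x, x + 1} \<and> y3 \<in> {y, y + 1} \<and> z3 \<in> {0, 1} \<and> z3 + 1 \<in> {0, 1}"
    using d(7) unfolding dz insert_subset K by blast
  then have 3: "x3 \<in> {x, x + 1}" "y3 \<in> {y, y + 1}" "z3 = 0" by auto
  have "dx \<noteq> dz" "dy \<noteq> dz" "dx \<noteq> dy" unfolding dx dy dz by (auto simp: doubleton_eq_iff)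
  moreover have "dx \<in> T" "dy \<in> T" "dz \<in> T" unfolding d(1) by simp_all
  ultimately have disj3: "dx \<inter> dz = {}" "dy \<inter> dz = {}" "dx \<inter> dy = {}"
    using disjointD[OF disj] by simp_all
  have y13: "y1 \<noteq> y3"
  proof
    assume "y1 = y3"
    then have "(x3, y1, z1) \<in> dx \<inter> dz" unfolding dx dz using 1 3 by auto
    then show False using disj3 by blast
  qed
  have x23: "x2 \<noteq> x3"
  proof
    assume "x2 = x3"
    then have "(x2, y3, z2) \<in> dy \<inter> dz" unfolding dy dz using 2 3 by auto
    then show False using disj3 by blast
  qed
  have z12: "z1 \<noteq> z2"
  proof
    assume "z1 = z2"
    then have "(x2, y1, z1) \<in> dx \<inter> dy" unfolding dx dy using 1 2 by auto
    then show False using disj3 by blast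
  qed
  let ?a = "(x3, y1)" and ?b = "(x2, y1)" and ?c = "(x2, y3)" and ?d = "(x3, y3)"
  have dx': "dx = {over ?a z1, over ?b z1}"
    unfolding dx over_def using 1(1) 2(1) 3(1) x23 by auto
  have dy': "dy = {over ?b z2, over ?c z2}"
    unfolding dy over_def using 1(2) 2(2) 3(2) y13 by auto
  have dz': "dz = {over ?d 0, over ?d 1}"
    unfolding dz over_def using 3(3) by auto
  obtain \<epsilon> where ar: "around \<epsilon> (x, y) ?a ?b ?c ?d"
  proof -
    have "x3 = x \<and> x2 = x + 1 \<or> x3 = x + 1 \<and> x2 = x" using 2(1) 3(1) x23 by auto
    moreover have "y3 = y \<and> y1 = y + 1 \<or> y3 = y + 1 \<and> y1 = y" using 1(2) 3(2) y13 by auto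
    ultimately have "around 1 (x, y) ?a ?b ?c ?d \<or> around (- 1) (x, y) ?a ?b ?c ?d"
      by (elim disjE conjE) (simp_all add: around_def ccw_def)
    then show thesis using that by blast
  qed
  have ar': "around (- \<epsilon>) (x, y) ?c ?b ?a ?d"
    using around_rotate[OF around_reverse[OF ar]] .
  note par = around_parity[OF ar]
  \<comment> \<open>The floor of the x-dimer tells which of its cubes is white, hence at which end
    the path starts.\<close>
  show thesis
  proof (cases "z1 = parity ?a")
    case True
    then have "z2 = parity ?b" using par z12 1(3) 2(3) by auto
    then have "T = trip ?a ?b ?c ?d" unfolding d(1) dx' dy' dz' trip_def True by simp
    then show thesis using that ar by blast
  next
    case False
    then have z1: "z1 = parity ?b" using par 1(3) parity_range[of ?a] by auto
    then have z2: "z2 = parity ?c" using par z12 1(3) 2(3) parity_range[of ?a] by auto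
    have "T = trip ?c ?b ?a ?d" unfolding d(1) dx' dy' dz' trip_def z1 z2 by (simp add: insert_commute)
    then show thesis using that ar' by blast
  qed
qed

text \<open>For the vertical dimer \<open>b - w\<close> is vertical of sign 1 - 2
  \<open>parity d\<close>. What remains is the planar cross product of the diagonal from
  \<open>c\<close> to \<open>a\<close> with the vector from the block center to \<open>d\<close>,
  whose sign is - \<epsilon>.\<close>

lemma chi_trip:
  assumes ar: "around \<epsilon> (x, y) a b c d"
  shows "chi (x, y, 0) (trip a b c d) {over d 0, over d 1} = of_int (\<epsilon> * (2 * parity d - 1))"
proof -
  note U = Union_trip[OF ar]
  note par = around_parity[OF ar]
  have dist: "distinct [a, b, c, d]" using ar by (rule around_distinct)
  have "big_cube (x, y, 0) = (\<lambda>s. over s 0) ` ({x, x + 1} \<times> {y, y + 1}) \<union> (\<lambda>s. over s 1) ` ({x, x + 1} \<times> {y, y + 1})"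
    by (auto simp: over_def)
  also have "{x, x + 1} \<times> {y, y + 1} = {a, b, c, d}" using around_set[OF ar] by simp
  finally have K: "big_cube (x, y, 0) = (\<lambda>s. over s 0) ` {a, b, c, d} \<union> (\<lambda>s. over s 1) ` {a, b, c, d}" .
  have rest: "big_cube (x, y, 0) - \<Union>(trip a b c d) = {over c (parity c), over a (1 - parity a)}"
    unfolding K U using dist par parity_range[of a] by auto
  have w: "white (over s (parity s))" "\<not> white (over s (1 - parity s))" for s
    using white_over[of "parity s" s] white_over[of "1 - parity s" s] parity_range[of s] by auto
  have dd: "{over d 0, over d 1} = {over d (parity d), over d (1 - parity d)}"
    using parity_range[of d] by auto
  have cubes: "white_cube (big_cube (x, y, 0) - \<Union>(trip a b c d)) = over c (parity c)"
    "black_cube (big_cube (x, y, 0) - \<Union>(trip a b c d)) = over a (1 - parity a)"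
    "white_cube {over d 0, over d 1} = over d (parity d)"
    "black_cube {over d 0, over d 1} = over d (1 - parity d)"
    unfolding rest dd using w by (simp_all add: white_black_cube)
  have pa: "parity a = 1 - parity d" "parity c = 1 - parity d" using par by auto
  have ctr: "cube_center (over s g) = vector [of_int (fst s) + 1/2, of_int (snd s) + 1/2, of_int g + 1/2]" for s g
    by (simp add: over_def)
  show ?thesis
    unfolding chi_def cubes Let_def ctr pa big_cube_center.simps
    using ar parity_range[of d] unfolding around_def ccw_def
    by (auto simp: det_3)
qed

section \<open>Windings about jewels and the change of P\<close>

context floor_tiling
begin

lemma center_notin_arcs:
  assumes "ghost_curves R G" "s \<in> jewels t"
  shows "square_center s \<notin> \<Union>(path_image ` arcs G t)"
proof -
  have "square_center s \<notin> path_image (seg (a, b))" if "(a, b) \<in> steps t" for a b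
  proof (rule center_notin_seg)
    show "adjacent a b" using that by (simp add: steps_iff)
    show "s \<noteq> a" "s \<noteq> b" using jewel_no_step[OF assms(2)] that by blast+
  qed
  moreover have "square_center s \<in> \<Union>(square_body ` (shadow R 0 \<inter> shadow R 1))"
  proof (rule UN_I)
    show "s \<in> shadow R 0 \<inter> shadow R 1" using jewels_subset assms(2) by blast
    show "square_center s \<in> square_body s" by (cases s) (simp add: in_cbox_complex_iff square_center.simps)
  qed
  ultimately show ?thesis using assms(1) unfolding arcs_eq ghost_curves_def by fast
qed

lemma of_int_jewel_winding:
  assumes G: "ghost_curves R G" and s: "s \<in> jewels t"
  shows "of_int (jewel_winding G t s) = total_winding (arcs G t) (square_center s)"
proof -
  note z = center_notin_arcs[OF assms] and A = balanced_arcs[OF G]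
  obtain k where k: "total_winding (arcs G t) (square_center s) = of_int k"
    using total_winding_integer[OF A z] by (auto elim: Ints_cases)
  have "jewel_winding G t s = k"
    unfolding jewel_winding_def sum_closed_curves[OF A z] k by simp
  then show ?thesis using k by simp
qed

text \<open>The half diagonal stays in the closed jewel square, which ghost curves avoid together
  with its boundary; this matters because \<open>corner p\<close> lies on that boundary.\<close>

lemma of_int_jewel_winding_corner:
  assumes G: "ghost_curves R G" and s: "s \<in> jewels t" "s \<in> {fst p, fst p + 1} \<times> {snd p, snd p + 1}"
  shows "of_int (jewel_winding G t s) = total_winding (arcs G t) (corner p)"
proof -
  let ?S = "closed_segment (square_center s) (corner p)"
  have "?S \<inter> path_image (seg (a, b)) = {}" if "(a, b) \<in> steps t" for a b
  proof (rule diagonal_avoids_seg[OF _ _ _ s(2)])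
    show "adjacent a b" using that by (simp add: steps_iff)
    show "s \<noteq> a" "s \<noteq> b" using jewel_no_step[OF s(1)] that by blast+
  qed
  moreover have "?S \<subseteq> \<Union>(square_body ` (shadow R 0 \<inter> shadow R 1))"
  proof -
    have "square_center s \<in> square_body s" "corner p \<in> square_body s"
      using s(2) by (cases s; auto simp: in_cbox_complex_iff square_center.simps corner_def)+
    moreover have "convex (square_body s)" by (cases s) simp
    ultimately have "?S \<subseteq> square_body s" by (simp add: closed_segment_subset)
    then show ?thesis using jewels_subset s(1) by blast
  qed
  ultimately have "?S \<inter> \<Union>(path_image ` arcs G t) = {}"
    using G unfolding arcs_eq ghost_curves_def by fast
  then have "total_winding (arcs G t) (square_center s) = total_winding (arcs G t) (corner p)"
    by (rule total_winding_eq[OF balanced_arcs[OF G] connected_segment(1)]) auto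
  then show ?thesis using of_int_jewel_winding[OF G s(1)] by simp
qed

lemma trip_P:
  assumes ar: "around \<epsilon> p a b c d" and T: "trip a b c d \<subseteq> t" and G: "ghost_curves R G"
    and t': "t' = (t - trip a b c d) \<union> trip a d c b" and col: "\<epsilon> = (if white_square d then 1 else - 1)"
  shows "\<exists>k::int. \<forall>q::real. q \<noteq> 0 \<longrightarrow> P G t' q - P G t q = q powi k * (q - 1)"
proof -
  note ex = trip_exchange[OF ar T t']
  have dist: "distinct [a, b, c, d]" using ar by (rule around_distinct)
  interpret t': floor_tiling R t' by (rule ex(1))
  have mem: "(a, b) \<in> steps t" "(b, c) \<in> steps t" "d \<in> jewels t"
    using T around_adjacent[OF ar] by (auto simp: trip_def steps_iff jewels_over)
  define J where "J = jewels t - {d}"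
  have nj: "a \<notin> jewels t" "b \<notin> jewels t" "c \<notin> jewels t" using mem jewel_no_step by blast+
  have J: "jewels t = insert d J" "jewels t' = insert b J" "d \<notin> J" "b \<notin> J" "finite J"
    using ex(3) mem(3) nj finite_jewels by (auto simp: J_def)
  have same: "jewel_winding G t' s = jewel_winding G t s" if "s \<in> J" for s
  proof -
    have s: "s \<in> jewels t" "s \<in> jewels t'" "s \<notin> {a, b, c, d}" using that J nj by auto
    have "wind (steps t') (square_center s) = wind (steps t) (square_center s)"
      using ex(4)[of "square_center s"] center_notin_seg[of a d s] center_notin_seg[of d c s] s(3)
        around_adjacent[OF ar] adjacent_commute loop_winding_center[OF ar s(3)] by auto
    then have "(of_int (jewel_winding G t' s) :: complex) = of_int (jewel_winding G t s)"
      unfolding of_int_jewel_winding[OF G s(1)] t'.of_int_jewel_winding[OF G s(2)]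
        total_winding_arcs[OF G] t'.total_winding_arcs[OF G] wind_def[symmetric] by simp
    then show ?thesis unfolding of_int_eq_iff .
  qed
  have moved: "jewel_winding G t' b = jewel_winding G t d - \<epsilon>"
  proof -
    have bd: "b \<in> {fst p, fst p + 1} \<times> {snd p, snd p + 1}" "d \<in> {fst p, fst p + 1} \<times> {snd p, snd p + 1}"
      unfolding around_set[OF ar, symmetric] by auto
    have "b \<in> jewels t'" using J by simp
    have "wind (steps t') (corner p) = wind (steps t) (corner p) - of_int \<epsilon>"
      using ex(4)[of "corner p"] around_adjacent[OF ar] adjacent_commute
      by (simp add: corner_notin_seg loop_winding_corner[OF ar])
    then have "(of_int (jewel_winding G t' b) :: complex) = of_int (jewel_winding G t d - \<epsilon>)"
      unfolding t'.of_int_jewel_winding_corner[OF G \<open>b \<in> jewels t'\<close> bd(1)] of_int_diff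
        of_int_jewel_winding_corner[OF G mem(3) bd(2)]
        total_winding_arcs[OF G] t'.total_winding_arcs[OF G] wind_def[symmetric] by simp
    then show ?thesis unfolding of_int_eq_iff .
  qed
  \<comment> \<open>Both squares are neighbours of \<open>a\<close>, so the moved jewel keeps its
    color and its sign in \<open>P\<close>.\<close>
  have wb: "white_square b = white_square d" unfolding white_square_parity using around_parity[OF ar] by simp
  let ?k0 = "jewel_winding G t d" and ?k1 = "jewel_winding G t' b"
  let ?B = "{j \<in> J. \<not> white_square j}" and ?W = "{j \<in> J. white_square j}"
  have fin: "finite ?B" "finite ?W" using J by auto
  have sums: "(\<Sum>j\<in>?B. q powi jewel_winding G t' j) = (\<Sum>j\<in>?B. q powi jewel_winding G t j)"
    "(\<Sum>j\<in>?W. q powi jewel_winding G t' j) = (\<Sum>j\<in>?W. q powi jewel_winding G t j)" for q :: real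
    using same by (auto intro: sum.cong)
  show ?thesis
  proof (cases "white_square d")
    case True
    have sets: "{j \<in> jewels t. \<not> white_square j} = ?B" "{j \<in> jewels t. white_square j} = insert d ?W"
      "{j \<in> jewels t'. \<not> white_square j} = ?B" "{j \<in> jewels t'. white_square j} = insert b ?W"
      using J True wb by auto
    have "P G t' q - P G t q = q powi ?k1 * (q - 1)" if "q \<noteq> 0" for q
    proof -
      \<comment> \<open>The minus sign of white jewels puts the old, larger exponent first.\<close>
      have "P G t' q - P G t q = q powi ?k0 - q powi ?k1"
        unfolding P_def sets using fin J sums[of q] by simp
      also have "?k0 = ?k1 + 1" using moved col True by simp
      finally show ?thesis using that by (simp add: power_int_add algebra_simps)
    qed
    then show ?thesis by blast
  next
    case False
    have sets: "{j \<in> jewels t. white_square j} = ?W" "{j \<in> jewels t. \<not> white_square j} = insert d ?B"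
      "{j \<in> jewels t'. white_square j} = ?W" "{j \<in> jewels t'. \<not> white_square j} = insert b ?B"
      using J False wb by auto
    have "P G t' q - P G t q = q powi ?k0 * (q - 1)" if "q \<noteq> 0" for q
    proof -
      have "P G t' q - P G t q = q powi ?k1 - q powi ?k0"
        unfolding P_def sets using fin J sums[of q] by simp
      also have "?k1 = ?k0 + 1" using moved col False by simp
      finally show ?thesis using that by (simp add: power_int_add algebra_simps)
    qed
    then show ?thesis by blast
  qed
qed

end

lemma P_has_derivative: "\<exists>D. (P G t has_field_derivative D) (at 1)"
  unfolding P_def[abs_def] by (rule exI, (rule derivative_eq_intros refl | simp)+)

text \<open>By the product rule q^k (q - 1) has derivative 1 at 1 for every \<open>k\<close>. The
  identity is given only for nonzero \<open>q\<close>, which is enough near 1.\<close>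

lemma deriv_P_diff:
  assumes "\<And>q::real. q \<noteq> 0 \<Longrightarrow> P G t' q - P G t q = q powi k * (q - 1)"
  shows "deriv (P G t') 1 - deriv (P G t) 1 = 1"
proof -
  obtain D where D: "(P G t has_field_derivative D) (at 1)" using P_has_derivative by blast
  have "((\<lambda>q. P G t q + q powi k * (q - 1)) has_field_derivative D + 1) (at 1)"
    by (rule derivative_eq_intros D refl | simp)+
  moreover have "\<forall>\<^sub>F q in nhds (1::real). P G t' q = P G t q + q powi k * (q - 1)"
  proof (rule eventually_mono)
    show "\<forall>\<^sub>F q in nhds (1::real). q \<in> - {0}" by (rule eventually_nhds_in_open) auto
    show "P G t' q = P G t q + q powi k * (q - 1)" if "q \<in> - {0}" for q
      using assms[of q] that by simp
  qed
  ultimately have "(P G t' has_field_derivative D + 1) (at 1)"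
    by (simp only: DERIV_cong_ev[OF refl _ refl])
  then show ?thesis using D by (simp add: DERIV_imp_deriv)
qed

theorem positive_trit_P:
  assumes R: "two_story_region R" and G: "ghost_curves R G" and t: "is_tiling R t0" "is_tiling R t1"
    and pos: "positive_trit R t0 t1"
  shows "(\<exists>k::int. \<forall>q::real. q \<noteq> 0 \<longrightarrow> P G t1 q - P G t0 q = q powi k * (q - 1)) \<and>
    deriv (P G t1) 1 - deriv (P G t0) 1 = 1"
proof -
  interpret floor_tiling R t0 by (rule two_story_floor_tiling[OF R t(1)])
  obtain v T T' where tr: "trit_at R v T T' t0 t1" and chi: "\<And>d. d \<in> T \<Longrightarrow> chi v T d = - 1"
    using pos unfolding positive_trit_def by blast
  obtain x y z where v: "v = (x, y, z)" by (cases v)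
  have tr': "big_cube v \<subseteq> R" "T \<subseteq> t0" "trit_triple v T" "is_tiling (\<Union>T) T'" "T' \<noteq> T" "t1 = (t0 - T) \<union> T'"
    using tr unfolding trit_at_def by auto
  have "(x, y, z) \<in> R" "(x, y, z + 1) \<in> R" using tr'(1) unfolding v by auto
  \<comment> \<open>Both layers of the cube lie in a region with floors 0 and 1 only.\<close>
  then have z: "z = 0" using floors[of "(x, y, z)"] floors[of "(x, y, z + 1)"] by auto
  have "disjoint T"
  proof (rule disjointI)
    show "A \<inter> B = {}" if "A \<in> T" "B \<in> T" "A \<noteq> B" for A B
      using tiling tr'(2) that by (intro disjointD[of t0]) (auto simp: is_tiling_def)
  qed
  then obtain \<epsilon> a b c d where ar: "around \<epsilon> (x, y) a b c d" and T: "T = trip a b c d"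
    using trit_triple_obtain_trip tr'(3) unfolding v z by metis
  have T': "T' = trip a d c b" using other_trip[OF ar] tr'(4,5) unfolding T by blast
  \<comment> \<open>The chirality of the vertical dimer alone ties the orientation \<epsilon> to the
    color of the jewel.\<close>
  have "{over d 0, over d 1} \<in> T" unfolding T trip_def by simp
  then have "of_int (\<epsilon> * (2 * parity d - 1)) = (- 1 :: real)"
    using chi chi_trip[OF ar] unfolding v z T by metis
  then have "of_int (\<epsilon> * (2 * parity d - 1)) = (of_int (- 1) :: real)" by simp
  then have e: "\<epsilon> * (2 * parity d - 1) = - 1" unfolding of_int_eq_iff .
  have "\<epsilon> = (if white_square d then 1 else - 1)"
    unfolding white_square_parity using e parity_range[of d] by auto
  then have ex: "\<exists>k::int. \<forall>q::real. q \<noteq> 0 \<longrightarrow> P G t1 q - P G t0 q = q powi k * (q - 1)"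
    using trip_P[OF ar _ G] tr'(2,6) unfolding T T' by blast
  then show ?thesis using deriv_P_diff by blast
qed

theorem theorem10p2:
  shows "(\<forall>R G t0 t1.
            two_story_region R \<and> ghost_curves R G \<and> is_tiling R t0 \<and> is_tiling R t1 \<and>
            positive_trit R t0 t1 \<longrightarrow>
              (\<exists>k::int. \<forall>q::real. q \<noteq> 0 \<longrightarrow> P G t1 q - P G t0 q = q powi k * (q - 1)) \<and>
              deriv (P G t1) 1 - deriv (P G t0) 1 = 1)
       \<and> (\<forall>R t0 t1.
            duplex_region R \<and> is_tiling R t0 \<and> is_tiling R t1 \<longrightarrow>
              (\<lambda>t t'. flip t t' \<or> trit R t t')\<^sup>*\<^sup>* t0 t1)"
  by (intro conjI[OF allI[OF allI[OF allI[OF allI[OF impI]]]] allI[OF allI[OF allI[OF impI]]]])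
    (elim conjE, rule positive_trit_P duplex_connected; assumption)+

end
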